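(* Let $\mathcal{L}$ be a non-degenerate probability law supported on $[0,\infty)$, let $(X_{i,j})_{i,j\ge 1}$ be i.i.d. with law $\mathcal{L}$, and let $(\theta_i)_{i\ge1}\in(0,\infty)^{\mathbb{N}}$ be a (possibly random) sequence. For each $n$, let $A=(\theta_iX_{i,j})_{i,j\in[n]}$, and let $P$, $\widehat Q$ and $Q$ be the following matrices: $P_{i,j}=A_{i,j}/\sum_{l\in[n]}A_{i,l}$; $\widehat Q_{i,j}=A_{i,j}/\sum_{l\ne i}A_{i,l}$ for $i\ne j$ and $\widehat Q_{i,i}=0$; and $Q_{i,j}=A_{i,j}$ for $i\neq j$, $Q_{i,i}=-\sum_{l\ne i}A_{i,l}$. Let $\pi_P,\pi_{\widehat Q},\pi_Q$ be the corresponding invariant distributions and let $u=(\frac1n,\dots,\frac1n)$. If $\mathcal{L}$ has a finite second moment, then, as $n\to\infty$, $$\|\pi-u\|_{\mathrm{TV}}=o(1)\quad\text{almost surely},\qquad \pi\in\{\pi_P,\pi_{\widehat Q}\}.$$ Furthermore, if $\theta_i=c$ for all $i$, for some constant $c\in(0,\infty)$, then also $\|\pi_Q-u\|_{\mathrm{TV}}=o(1)$ almost surely.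
   Context: Notation: $[n]=\{1,\dots,n\}$. For a signed measure $\nu$ on $[n]$, $\|\nu\|_{\mathrm{TV}}=\frac12\sum_{i\in[n]}|\nu(i)|$. "Non-degenerate" means that $\mathcal{L}$ is not a point mass; $\mathcal{L}$ may have an atom at $0$. All matrices depend on $n$ and are built from the same infinite array $(X_{i,j})_{i,j\ge1}$ and the same infinite sequence $(\theta_i)_{i\ge1}$. $P$ and $\widehat Q$ are stochastic kernels (they do not depend on $\theta$), and $Q$ is a Markov generator. The invariant distributions are the unique probability (row) vectors satisfying $\pi_PP=\pi_P$, $\pi_{\widehat Q}\widehat Q=\pi_{\widehat Q}$ and $\pi_QQ=0$. Let $\widehat A$ be $A$ with its diagonal entries replaced by $0$. Almost surely, for all sufficiently large $n$, both $A$ and $\widehat A$ are primitive; on this event $P,\widehat Q,Q$ are well-defined and irreducible, $P$ and $\widehat Q$ are aperiodic, and the invariant distributions exist and are unique. The statement concerns such $n$. "$Z_n=o(1)$ a.s." means $Z_n\to0$ almost surely. *)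

theory Defs
  imports "HOL-Probability.Probability"
begin

text \<open>
  Matrices and vectors indexed by \<open>[n] = {1..n}\<close> are functions on \<open>nat\<close>; only
  their values at indices in \<open>{1..n}\<close> are used. The size \<open>n\<close> is an explicit argument
  because it varies in the limit.
\<close>

definition scaled_matrix :: "(nat \<Rightarrow> real) \<Rightarrow> (nat \<Rightarrow> nat \<Rightarrow> real) \<Rightarrow> nat \<Rightarrow> nat \<Rightarrow> real" where
  "scaled_matrix \<theta> X i j = \<theta> i * X i j"

definition kernel_P :: "nat \<Rightarrow> (nat \<Rightarrow> nat \<Rightarrow> real) \<Rightarrow> nat \<Rightarrow> nat \<Rightarrow> real" where
  "kernel_P n A i j = A i j / (\<Sum>l\<in>{1..n}. A i l)"

definition kernel_Q_hat :: "nat \<Rightarrow> (nat \<Rightarrow> nat \<Rightarrow> real) \<Rightarrow> nat \<Rightarrow> nat \<Rightarrow> real" where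
  "kernel_Q_hat n A i j = (if i = j then 0 else A i j / (\<Sum>l\<in>{1..n} - {i}. A i l))"

definition generator_Q :: "nat \<Rightarrow> (nat \<Rightarrow> nat \<Rightarrow> real) \<Rightarrow> nat \<Rightarrow> nat \<Rightarrow> real" where
  "generator_Q n A i j = (if i = j then - (\<Sum>l\<in>{1..n} - {i}. A i l) else A i j)"

text \<open>
  Probability vectors on \<open>{1..n}\<close> are required to vanish outside \<open>{1..n}\<close>, so that
  they are determined as functions by their entries and uniqueness below means uniqueness
  on \<open>{1..n}\<close>.
\<close>

definition prob_vector :: "nat \<Rightarrow> (nat \<Rightarrow> real) \<Rightarrow> bool" where
  "prob_vector n p \<longleftrightarrow>
     (\<forall>i\<in>{1..n}. 0 \<le> p i) \<and> (\<Sum>i\<in>{1..n}. p i) = 1 \<and> (\<forall>i. i \<notin> {1..n} \<longrightarrow> p i = 0)"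

definition row_mult :: "nat \<Rightarrow> (nat \<Rightarrow> real) \<Rightarrow> (nat \<Rightarrow> nat \<Rightarrow> real) \<Rightarrow> nat \<Rightarrow> real" where
  "row_mult n p K j = (\<Sum>i\<in>{1..n}. p i * K i j)"

text \<open>
  The two definite descriptions are meaningful whenever the invariant vector exists and is
  unique. Otherwise (for instance if a row of \<open>A\<close> vanishes) their value is unspecified.
\<close>

definition kernel_invariant :: "nat \<Rightarrow> (nat \<Rightarrow> nat \<Rightarrow> real) \<Rightarrow> nat \<Rightarrow> real" where
  "kernel_invariant n K =
     (THE p. prob_vector n p \<and> (\<forall>j\<in>{1..n}. row_mult n p K j = p j))"

definition generator_invariant :: "nat \<Rightarrow> (nat \<Rightarrow> nat \<Rightarrow> real) \<Rightarrow> nat \<Rightarrow> real" where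
  "generator_invariant n G =
     (THE p. prob_vector n p \<and> (\<forall>j\<in>{1..n}. row_mult n p G j = 0))"

definition tv_norm :: "nat \<Rightarrow> (nat \<Rightarrow> real) \<Rightarrow> real" where
  "tv_norm n \<nu> = (1 / 2) * (\<Sum>i\<in>{1..n}. \<bar>\<nu> i\<bar>)"

definition uniform_vector :: "nat \<Rightarrow> nat \<Rightarrow> real" where
  "uniform_vector n i = (if i \<in> {1..n} then 1 / real n else 0)"

end

theory Submission
  imports Defs
begin

text \<open>
  Write \<open>m\<close> for the mean of \<open>\<L>\<close> and \<open>\<parallel>Y\<parallel>\<close> for the operator norm of a matrix \<open>Y\<close> on \<open>\<ell>\<^sup>2\<close>. The
  positive scalars \<open>\<theta>\<^sub>i\<close> cancel in the row normalisation, so \<open>P\<close> and \<open>Q\<close>-hat are the row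
  normalisations of \<open>X\<close> and of \<open>X\<close> with its diagonal erased. Two almost sure facts about the array
  \<open>X\<close> suffice, and everything else is deterministic:
  
    \<^item> (flatness) the \<open>n \<times> n\<close> corner of \<open>Y = X - m\<close> satisfies \<open>\<parallel>Y\<parallel> = o(n)\<close>;
    \<^item> (row sums) for some \<open>c > 0\<close>, eventually all \<open>n\<close> row sums \<open>S\<^sub>i\<close> of the corner are at least
      \<open>c n\<close>.
  
  \<^emph>\<open>The deterministic part.\<close> For a row vector \<open>x\<close> put \<open>w\<^sub>i = x\<^sub>i / S\<^sub>i\<close>. Then \<open>x P = w X\<close> is a
  constant vector plus \<open>w Y\<close>. Its mean is the mean of \<open>x\<close> because \<open>P\<close> preserves total mass, and
  subtracting the mean does not increase the \<open>\<ell>\<^sup>2\<close> norm, so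
  \<open>\<parallel>x P - mean x\<parallel> \<le> \<parallel>Y\<parallel> \<parallel>w\<parallel> \<le> (\<parallel>Y\<parallel> / (c n)) \<parallel>x\<parallel> = o(1) \<parallel>x\<parallel>\<close>. Hence \<open>P\<close> is a strict
  contraction on vectors of total mass zero, which yields existence and uniqueness of the invariant
  vector \<open>\<pi>\<close>. Applied to \<open>x = \<pi>\<close> the same inequality says
  \<open>\<parallel>\<pi> - u\<parallel> = o(1) \<parallel>\<pi>\<parallel> = o(n\<^sup>-\<^sup>1\<^sup>/\<^sup>2)\<close>, and Cauchy-Schwarz turns this into total variation
  \<open>o(1)\<close>. Erasing the diagonal costs at most \<open>max X\<^sub>i\<^sub>i \<le> m + \<parallel>Y\<parallel> = o(n)\<close> in operator norm. The
  balance equations \<open>\<pi>\<^sub>j S\<^sub>j = m + (\<pi> Y)\<^sub>j\<close> of the generator are treated in the same way; there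
  the fluctuations of \<open>S\<^sub>j\<close> about \<open>m n\<close> do not cancel, but they are small on average because
  \<open>\<Sum>\<^sub>j \<bar>S\<^sub>j - m n\<bar> = \<epsilon> Y 1\<close> for a sign vector \<open>\<epsilon>\<close>, which is at most \<open>n \<parallel>Y\<parallel>\<close>.
  
  \<^emph>\<open>The probabilistic part.\<close> Both facts follow from the first Borel-Cantelli argument in the
  form: nonnegative variables with summable expectations tend to \<open>0\<close> almost surely. The row sums
  are handled by an exponential Markov inequality, as \<open>E exp(- X) < 1\<close>. For flatness,
  \<open>\<parallel>Y\<parallel>\<close> is monotone in \<open>n\<close>, so that \<open>n = 2\<^sup>k\<close> suffices. At that scale entries above
  \<open>2\<^sup>k\<close> are removed and the rest is centred to a matrix \<open>Z\<close>; then \<open>\<parallel>Z\<parallel>\<^sup>4\<close> is at most the squared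
  Frobenius norm of \<open>Z Z\<^sup>T\<close>, whose expectation is of order \<open>n\<^sup>3 + n\<^sup>2 E Z\<^sub>1\<^sub>1\<^sup>4\<close>. Divided by \<open>n\<^sup>4\<close>
  this is summable along \<open>n = 2\<^sup>k\<close>, and so is the expected number of removed entries: both
  reduce to \<open>\<Sum>\<^sub>k min (4\<^sup>k, x\<^sup>4 / 4\<^sup>k) \<le> 4 x\<^sup>2\<close>, which is where the finite second moment enters.
\<close>

section \<open>Operator norm bounds for matrices acting on row vectors\<close>

text \<open>
  Invariant distributions are row vectors, so matrices act from the right. The size \<open>n\<close> is a
  variable, hence the norm bound is a predicate on functions instead of an operator norm on a
  fixed Euclidean space.
\<close>

definition left_op_bound :: "nat \<Rightarrow> (nat \<Rightarrow> nat \<Rightarrow> real) \<Rightarrow> real \<Rightarrow> bool" where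
  "left_op_bound n Y K \<longleftrightarrow>
     (\<forall>x. L2_set (row_mult n x Y) {1..n} \<le> K * L2_set x {1..n})"

lemma left_op_boundD:
  "left_op_bound n Y K \<Longrightarrow> L2_set (row_mult n x Y) {1..n} \<le> K * L2_set x {1..n}"
  by (simp add: left_op_bound_def)

lemma left_op_bound_weaken:
  assumes "left_op_bound n Y K" "K \<le> K'"
  shows "left_op_bound n Y K'"
  unfolding left_op_bound_def
proof
  fix x
  have "K * L2_set x {1..n} \<le> K' * L2_set x {1..n}"
    using assms(2) by (intro mult_right_mono) auto
  with left_op_boundD[OF assms(1), of x]
  show "L2_set (row_mult n x Y) {1..n} \<le> K' * L2_set x {1..n}" by linarith
qed

lemma row_mult_cong:
  assumes "\<And>i. i \<in> {1..n} \<Longrightarrow> x i * Y i j = x' i * Z i j"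
  shows "row_mult n x Y j = row_mult n x' Z j"
  using assms unfolding row_mult_def by (intro sum.cong) auto

lemma left_op_bound_cong:
  assumes "\<And>i j. i \<in> {1..n} \<Longrightarrow> j \<in> {1..n} \<Longrightarrow> Y i j = Z i j"
  shows "left_op_bound n Y K \<longleftrightarrow> left_op_bound n Z K"
proof -
  have "L2_set (row_mult n x Y) {1..n} = L2_set (row_mult n x Z) {1..n}" for x
    by (intro L2_set_cong refl row_mult_cong) (simp add: assms)
  then show ?thesis by (simp add: left_op_bound_def)
qed

lemma left_op_bound_add:
  assumes "left_op_bound n Y K" "left_op_bound n Z K'"
  shows "left_op_bound n (\<lambda>i j. Y i j + Z i j) (K + K')"
  unfolding left_op_bound_def
proof
  fix x
  have "row_mult n x (\<lambda>i j. Y i j + Z i j) = (\<lambda>j. row_mult n x Y j + row_mult n x Z j)"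
    by (auto simp: row_mult_def algebra_simps sum.distrib)
  then have "L2_set (row_mult n x (\<lambda>i j. Y i j + Z i j)) {1..n}
      \<le> L2_set (row_mult n x Y) {1..n} + L2_set (row_mult n x Z) {1..n}"
    by (simp add: L2_set_triangle_ineq)
  with left_op_boundD[OF assms(1), of x] left_op_boundD[OF assms(2), of x]
  show "L2_set (row_mult n x (\<lambda>i j. Y i j + Z i j)) {1..n} \<le> (K + K') * L2_set x {1..n}"
    by (simp add: algebra_simps)
qed

lemma sum_abs_le_L2_set:
  "(\<Sum>i\<in>{1..n::nat}. \<bar>x i\<bar>) \<le> sqrt (real n) * L2_set x {1..n}"
  using L2_set_mult_ineq[of "\<lambda>_. 1" x "{1..n}"] by (simp add: L2_set_constant)

lemma L2_set_mono_abs: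
  assumes "\<And>i. i \<in> A \<Longrightarrow> \<bar>f i\<bar> \<le> g i"
  shows "L2_set f A \<le> L2_set g A"
proof -
  have "L2_set f A = L2_set (\<lambda>i. \<bar>f i\<bar>) A" by (simp add: L2_set_def)
  also have "\<dots> \<le> L2_set g A" using assms by (intro L2_set_mono) auto
  finally show ?thesis .
qed

text \<open>
  Extending \<open>x\<close> by zero and dropping coordinates of the image can only help. This monotonicity
  in \<open>n\<close> is what permits restricting to sizes \<open>2\<^sup>k\<close> later on.
\<close>

lemma left_op_bound_submatrix:
  assumes "left_op_bound N Y K" "n \<le> N"
  shows "left_op_bound n Y K"
  unfolding left_op_bound_def
proof
  fix x
  define x' :: "nat \<Rightarrow> real" where "x' i = (if i \<in> {1..n} then x i else 0)" for i
  have eq: "row_mult N x' Y j = row_mult n x Y j" for j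
    unfolding row_mult_def x'_def using assms(2) by (intro sum.mono_neutral_cong_right) auto
  have "L2_set (row_mult n x Y) {1..n} \<le> L2_set (row_mult N x' Y) {1..N}"
    unfolding L2_set_def eq using assms(2) by (intro real_sqrt_le_mono sum_mono2) auto
  moreover have "L2_set x' {1..N} = L2_set x {1..n}"
    unfolding L2_set_def x'_def using assms(2)
    by (intro arg_cong[where f=sqrt] sum.mono_neutral_cong_right) auto
  ultimately show "L2_set (row_mult n x Y) {1..n} \<le> K * L2_set x {1..n}"
    using left_op_boundD[OF assms(1), of x'] by simp
qed

lemma left_op_bound_const: "left_op_bound n (\<lambda>i j. a) (real n * \<bar>a\<bar>)"
  unfolding left_op_bound_def
proof
  fix x
  have "row_mult n x (\<lambda>i j. a) = (\<lambda>j. (\<Sum>i\<in>{1..n}. x i) * a)"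
    by (intro ext) (simp only: row_mult_def sum_distrib_right)
  then have "L2_set (row_mult n x (\<lambda>i j. a)) {1..n} = sqrt n * (\<bar>\<Sum>i\<in>{1..n}. x i\<bar> * \<bar>a\<bar>)"
    by (simp add: L2_set_constant abs_mult)
  also have "\<dots> \<le> sqrt n * ((sqrt n * L2_set x {1..n}) * \<bar>a\<bar>)"
    by (intro mult_left_mono mult_right_mono order_trans[OF sum_abs sum_abs_le_L2_set]) auto
  also have "\<dots> = (sqrt n * sqrt n) * \<bar>a\<bar> * L2_set x {1..n}" by (simp only: mult_ac)
  also have "sqrt n * sqrt n = real n" by simp
  finally show "L2_set (row_mult n x (\<lambda>i j. a)) {1..n} \<le> real n * \<bar>a\<bar> * L2_set x {1..n}" .
qed

lemma left_op_bound_diagonal: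
  assumes "\<And>i. i \<in> {1..n} \<Longrightarrow> \<bar>d i\<bar> \<le> K" "0 \<le> K"
  shows "left_op_bound n (\<lambda>i j. if i = j then d i else 0) K"
  unfolding left_op_bound_def
proof
  fix x
  have "row_mult n x (\<lambda>i j. if i = j then d i else 0) j = x j * d j" if "j \<in> {1..n}" for j
  proof -
    have "row_mult n x (\<lambda>i j. if i = j then d i else 0) j
        = (\<Sum>i\<in>{1..n}. if i = j then x i * d i else 0)"
      unfolding row_mult_def by (intro sum.cong) auto
    then show ?thesis using that by (simp add: sum.delta)
  qed
  then have "L2_set (row_mult n x (\<lambda>i j. if i = j then d i else 0)) {1..n}
      \<le> L2_set (\<lambda>j. K * \<bar>x j\<bar>) {1..n}"
    by (intro L2_set_mono_abs) (use assms in \<open>simp add: abs_mult mult.commute mult_right_mono\<close>)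
  also have "\<dots> = K * L2_set x {1..n}"
    using assms(2) by (simp add: L2_set_right_distrib[symmetric]) (simp add: L2_set_def)
  finally show "L2_set (row_mult n x (\<lambda>i j. if i = j then d i else 0)) {1..n}
      \<le> K * L2_set x {1..n}" .
qed

lemma left_op_bound_entry:
  assumes "left_op_bound n Y K" "i \<in> {1..n}" "j \<in> {1..n}"
  shows "\<bar>Y i j\<bar> \<le> K"
proof -
  define e where "e k = (if k = i then 1 else 0 :: real)" for k
  have "row_mult n e Y j = Y i j"
    using assms(2) unfolding row_mult_def e_def by (simp add: if_distrib if_distribR cong: if_cong)
  moreover have "L2_set e {1..n} = 1"
    using assms(2) unfolding L2_set_def e_def by (simp add: if_distrib[of "\<lambda>t. t\<^sup>2"] cong: if_cong)
  moreover have "\<bar>row_mult n e Y j\<bar> \<le> L2_set (\<lambda>j. \<bar>row_mult n e Y j\<bar>) {1..n}"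
    using assms(3) by (intro member_le_L2_set) auto
  ultimately show ?thesis
    using left_op_boundD[OF assms(1), of e] by (simp add: L2_set_def)
qed

text \<open>
  With \<open>G = Y Y\<^sup>T\<close> one has \<open>\<parallel>x Y\<parallel>\<^sup>2 = \<Sum> x\<^sub>i x\<^sub>k G\<^sub>i\<^sub>k\<close>, and Cauchy-Schwarz over pairs of indices
  bounds this by \<open>\<parallel>x\<parallel>\<^sup>2\<close> times the Frobenius norm of \<open>G\<close>. For independent
  centred entries this gains over the Frobenius norm of \<open>Y\<close>, which is of order \<open>n\<close>: the entries of
  \<open>G\<close> off the diagonal are sums with cancellation.
\<close>

lemma left_op_bound_gram:
  assumes "(\<Sum>i\<in>{1..n}. \<Sum>i'\<in>{1..n}. (\<Sum>j\<in>{1..n}. Y i j * Y i' j)\<^sup>2) \<le> K ^ 4" "0 \<le> K"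
  shows "left_op_bound n Y K"
  unfolding left_op_bound_def
proof
  fix x
  define I where "I = {1..n}"
  define G :: "nat \<times> nat \<Rightarrow> real" where "G = (\<lambda>(i, i'). \<Sum>j\<in>I. Y i j * Y i' j)"
  define xx :: "nat \<times> nat \<Rightarrow> real" where "xx = (\<lambda>(i, i'). x i * x i')"
  have "(L2_set (row_mult n x Y) I)\<^sup>2 = (\<Sum>j\<in>I. (\<Sum>i\<in>I. x i * Y i j)\<^sup>2)"
    by (simp add: L2_set_def row_mult_def I_def sum_nonneg)
  also have "\<dots> = (\<Sum>j\<in>I. \<Sum>i\<in>I. \<Sum>i'\<in>I. (x i * Y i j) * (x i' * Y i' j))"
    by (simp add: power2_eq_square sum_product)
  also have "\<dots> = (\<Sum>i\<in>I. \<Sum>j\<in>I. \<Sum>i'\<in>I. (x i * Y i j) * (x i' * Y i' j))"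
    by (rule sum.swap)
  also have "\<dots> = (\<Sum>i\<in>I. \<Sum>i'\<in>I. \<Sum>j\<in>I. (x i * Y i j) * (x i' * Y i' j))"
    by (intro sum.cong refl sum.swap)
  also have "\<dots> = (\<Sum>p\<in>I\<times>I. xx p * G p)"
    by (simp add: G_def xx_def sum_distrib_left sum.cartesian_product' mult_ac)
  also have "\<dots> \<le> (\<Sum>p\<in>I\<times>I. \<bar>xx p\<bar> * \<bar>G p\<bar>)"
    by (intro sum_mono) (simp flip: abs_mult)
  also have "\<dots> \<le> L2_set xx (I\<times>I) * L2_set G (I\<times>I)"
    by (rule L2_set_mult_ineq)
  also have "L2_set xx (I\<times>I) = (L2_set x I)\<^sup>2"
  proof -
    have "(\<Sum>p\<in>I\<times>I. (xx p)\<^sup>2) = (\<Sum>i\<in>I. (x i)\<^sup>2) * (\<Sum>i\<in>I. (x i)\<^sup>2)"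
      by (simp add: xx_def sum_product power_mult_distrib sum.cartesian_product')
    then show ?thesis by (simp add: L2_set_def sum_nonneg)
  qed
  also have "(L2_set x I)\<^sup>2 * L2_set G (I\<times>I) \<le> (L2_set x I)\<^sup>2 * K\<^sup>2"
  proof -
    have "(\<Sum>p\<in>I\<times>I. (G p)\<^sup>2) \<le> (K\<^sup>2)\<^sup>2"
      using assms(1) by (simp add: G_def I_def sum.cartesian_product')
    then have "L2_set G (I\<times>I) \<le> K\<^sup>2"
      unfolding L2_set_def by (intro real_le_lsqrt) auto
    then show ?thesis by (intro mult_left_mono) auto
  qed
  also have "\<dots> = (K * L2_set x I)\<^sup>2"
    by (simp only: power_mult_distrib mult.commute)
  finally have "(L2_set (row_mult n x Y) I)\<^sup>2 \<le> (K * L2_set x I)\<^sup>2" .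
  then show "L2_set (row_mult n x Y) {1..n} \<le> K * L2_set x {1..n}"
    using assms(2) unfolding I_def by (auto intro: power2_le_imp_le)
qed

text \<open>
  Subtracting the mean is the orthogonal projection onto vectors of total mass zero.
\<close>

lemma L2_set_centred_le:
  fixes v :: "nat \<Rightarrow> real"
  assumes "1 \<le> n"
  shows "L2_set (\<lambda>j. v j - (\<Sum>i\<in>{1..n}. v i) / real n) {1..n} \<le> L2_set v {1..n}"
proof -
  define a where "a = (\<Sum>i\<in>{1..n}. v i) / real n"
  have na: "(\<Sum>i\<in>{1..n}. v i) = real n * a" using assms by (simp add: a_def)
  have "(\<Sum>j\<in>{1..n}. (v j - a)\<^sup>2)
      = (\<Sum>j\<in>{1..n}. (v j)\<^sup>2) - 2 * a * (\<Sum>j\<in>{1..n}. v j) + real n * a\<^sup>2"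
    by (simp add: power2_diff sum.distrib sum_subtractf sum_distrib_left algebra_simps)
  also have "\<dots> = (\<Sum>j\<in>{1..n}. (v j)\<^sup>2) - real n * a\<^sup>2"
    by (simp only: na) (simp add: power2_eq_square)
  finally show ?thesis
    unfolding L2_set_def a_def[symmetric] by (intro real_sqrt_le_mono) simp
qed

section \<open>Kernels and generators of rescaled matrices\<close>

text \<open>
  The diagonal of \<open>B\<close> may be included on both sides of the balance equation, since its two
  contributions cancel; this puts kernel and generator on the same footing.
\<close>

lemma row_mult_generator_Q:
  assumes "j \<in> {1..n}"
  shows "row_mult n p (generator_Q n B) j = row_mult n p B j - p j * (\<Sum>l\<in>{1..n}. B j l)"
proof -
  have "row_mult n p (generator_Q n B) j
      = p j * generator_Q n B j j + (\<Sum>i\<in>{1..n} - {j}. p i * generator_Q n B i j)"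
    unfolding row_mult_def using assms by (intro sum.remove) auto
  also have "\<dots> = - p j * (\<Sum>l\<in>{1..n} - {j}. B j l) + (\<Sum>i\<in>{1..n} - {j}. p i * B i j)"
    by (auto simp: generator_Q_def intro!: arg_cong2[where f="(+)"] sum.cong)
  also have "(\<Sum>i\<in>{1..n} - {j}. p i * B i j) = row_mult n p B j - p j * B j j"
    unfolding row_mult_def using assms by (subst sum.remove[of "{1..n}" j]) auto
  also have "(\<Sum>l\<in>{1..n} - {j}. B j l) = (\<Sum>l\<in>{1..n}. B j l) - B j j"
    using assms by (subst sum.remove[of "{1..n}" j]) auto
  finally show ?thesis by (simp add: algebra_simps)
qed

lemma generator_invariant_scale:
  assumes "a \<noteq> 0" "\<And>i j. i \<in> {1..n} \<Longrightarrow> j \<in> {1..n} \<Longrightarrow> A i j = a * B i j"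
  shows "generator_invariant n (generator_Q n A) = generator_invariant n (generator_Q n B)"
proof -
  have "row_mult n p (generator_Q n A) j = a * row_mult n p (generator_Q n B) j"
    if "j \<in> {1..n}" for p j
  proof -
    have "row_mult n p A j = a * row_mult n p B j"
      unfolding row_mult_def sum_distrib_left using that by (intro sum.cong) (auto simp: assms(2))
    moreover have "(\<Sum>l\<in>{1..n}. A j l) = a * (\<Sum>l\<in>{1..n}. B j l)"
      unfolding sum_distrib_left using that by (intro sum.cong) (auto simp: assms(2))
    ultimately show ?thesis by (simp add: row_mult_generator_Q[OF that] algebra_simps)
  qed
  then have "(\<forall>j\<in>{1..n}. row_mult n p (generator_Q n A) j = 0)
      \<longleftrightarrow> (\<forall>j\<in>{1..n}. row_mult n p (generator_Q n B) j = 0)" for p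
    using assms(1) by simp
  then show ?thesis by (simp add: generator_invariant_def)
qed

lemma kernel_invariant_cong:
  assumes "\<And>i j. i \<in> {1..n} \<Longrightarrow> j \<in> {1..n} \<Longrightarrow> K i j = K' i j"
  shows "kernel_invariant n K = kernel_invariant n K'"
proof -
  have "row_mult n p K j = row_mult n p K' j" if "j \<in> {1..n}" for p j
    using that assms by (intro row_mult_cong) auto
  then have "(\<forall>j\<in>{1..n}. row_mult n p K j = p j) \<longleftrightarrow> (\<forall>j\<in>{1..n}. row_mult n p K' j = p j)" for p
    by simp
  then show ?thesis by (simp add: kernel_invariant_def)
qed

lemma kernel_P_scaled_matrix:
  assumes "\<theta> i \<noteq> 0"
  shows "kernel_P n (scaled_matrix \<theta> X) i j = kernel_P n X i j"
  using assms by (simp add: kernel_P_def scaled_matrix_def flip: sum_distrib_left)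

lemma kernel_Q_hat_eq_kernel_P:
  assumes "\<theta> i \<noteq> 0"
  shows "kernel_Q_hat n (scaled_matrix \<theta> X) i j
    = kernel_P n (\<lambda>i j. if i = j then 0 else X i j) i j"
proof -
  have "(\<Sum>l\<in>{1..n}. if i = l then 0 else X i l) = (\<Sum>l\<in>{1..n} - {i}. X i l)"
    by (intro sum.mono_neutral_cong_right) auto
  then show ?thesis
    using assms by (simp add: kernel_Q_hat_def kernel_P_def scaled_matrix_def flip: sum_distrib_left)
qed

section \<open>Invariant vectors of a nearly constant matrix\<close>

text \<open>
  A nonnegative matrix close to the constant \<open>m\<close> in operator norm, relative to its size, whose row
  sums are bounded below by a multiple of \<open>n\<close>. The condition \<open>\<delta> \<le> c / 2\<close> makes the contraction factor \<open>\<delta> / c\<close> at most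
  one half.
\<close>

locale nearly_flat_matrix =
  fixes n :: nat and B :: "nat \<Rightarrow> nat \<Rightarrow> real" and m c \<delta> :: real
  assumes n_pos: "1 \<le> n"
    and c_pos: "0 < c"
    and \<delta>_nonneg: "0 \<le> \<delta>"
    and \<delta>_small: "\<delta> \<le> c / 2"
    and nonneg: "\<And>i j. i \<in> {1..n} \<Longrightarrow> j \<in> {1..n} \<Longrightarrow> 0 \<le> B i j"
    and row_sum_ge: "\<And>i. i \<in> {1..n} \<Longrightarrow> c * real n \<le> (\<Sum>l\<in>{1..n}. B i l)"
    and deviation: "left_op_bound n (\<lambda>i j. B i j - m) (\<delta> * real n)"
begin

definition S :: "nat \<Rightarrow> real" where "S i = (\<Sum>l\<in>{1..n}. B i l)"

definition Y :: "nat \<Rightarrow> nat \<Rightarrow> real" where "Y i j = B i j - m"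

lemma cn_pos: "0 < c * real n"
  using c_pos n_pos by simp

lemma S_ge: "i \<in> {1..n} \<Longrightarrow> c * real n \<le> S i"
  unfolding S_def by (rule row_sum_ge)

lemma S_pos: "i \<in> {1..n} \<Longrightarrow> 0 < S i"
  using S_ge cn_pos by (meson less_le_trans)

lemma Y_bound: "L2_set (row_mult n x Y) {1..n} \<le> \<delta> * real n * L2_set x {1..n}"
  using left_op_boundD[OF deviation, of x] unfolding Y_def[abs_def] by simp

lemma row_mult_B: "row_mult n x B j = m * (\<Sum>i\<in>{1..n}. x i) + row_mult n x Y j"
  by (simp add: row_mult_def Y_def right_diff_distrib sum_subtractf sum_distrib_left mult.commute)

lemma row_mult_kernel: "row_mult n x (kernel_P n B) j = row_mult n (\<lambda>i. x i / S i) B j"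
  by (simp add: row_mult_def kernel_P_def S_def)

lemma sum_row_mult_kernel:
  "(\<Sum>j\<in>{1..n}. row_mult n x (kernel_P n B) j) = (\<Sum>i\<in>{1..n}. x i)"
proof -
  have "(\<Sum>j\<in>{1..n}. row_mult n x (kernel_P n B) j)
      = (\<Sum>i\<in>{1..n}. x i * ((\<Sum>j\<in>{1..n}. B i j) / S i))"
    unfolding row_mult_def kernel_P_def S_def sum_distrib_left sum_divide_distrib
    by (subst sum.swap) simp
  also have "\<dots> = (\<Sum>i\<in>{1..n}. x i)"
  proof (intro sum.cong refl)
    fix i assume "i \<in> {1..n}"
    then show "x i * ((\<Sum>j\<in>{1..n}. B i j) / S i) = x i"
      using S_pos[of i] unfolding S_def[symmetric] by simp
  qed
  finally show ?thesis .
qed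

lemma L2_set_div_S_le: "L2_set (\<lambda>i. x i / S i) {1..n} \<le> L2_set x {1..n} / (c * real n)"
proof -
  have "L2_set (\<lambda>i. x i / S i) {1..n} \<le> L2_set (\<lambda>i. \<bar>x i\<bar> * (1 / (c * real n))) {1..n}"
  proof (rule L2_set_mono_abs)
    fix i assume "i \<in> {1..n}"
    then show "\<bar>x i / S i\<bar> \<le> \<bar>x i\<bar> * (1 / (c * real n))"
      using S_ge[of i] S_pos[of i] cn_pos by (simp add: abs_divide divide_left_mono)
  qed
  also have "\<dots> = L2_set (\<lambda>i. \<bar>x i\<bar>) {1..n} * (1 / (c * real n))"
    using cn_pos by (intro L2_set_left_distrib[symmetric]) simp
  finally show ?thesis by (simp add: L2_set_def)
qed

text \<open>
  The central estimate. With \<open>w\<^sub>i = x\<^sub>i / S\<^sub>i\<close>, the image \<open>x P = w B\<close> differs from \<open>w Y\<close> by a constant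
  vector, and centring removes this constant; the mean of \<open>x P\<close> is that of \<open>x\<close> as \<open>P\<close> is stochastic.
\<close>

lemma kernel_centred_le:
  "L2_set (\<lambda>j. row_mult n x (kernel_P n B) j - (\<Sum>i\<in>{1..n}. x i) / real n) {1..n}
     \<le> \<delta> / c * L2_set x {1..n}"
proof -
  define w where "w = (\<lambda>i. x i / S i)"
  define a where "a = m * (\<Sum>i\<in>{1..n}. w i)"
  have xP: "row_mult n x (kernel_P n B) j = a + row_mult n w Y j" for j
    by (simp add: row_mult_kernel w_def[symmetric] row_mult_B a_def)
  have "(\<Sum>i\<in>{1..n}. x i) = real n * a + (\<Sum>j\<in>{1..n}. row_mult n w Y j)"
    using sum_row_mult_kernel[of x] by (simp add: xP sum.distrib)
  then have "(\<Sum>i\<in>{1..n}. x i) / real n = a + (\<Sum>j\<in>{1..n}. row_mult n w Y j) / real n"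
    using n_pos by (simp add: field_simps)
  then have "(\<lambda>j. row_mult n x (kernel_P n B) j - (\<Sum>i\<in>{1..n}. x i) / real n)
      = (\<lambda>j. row_mult n w Y j - (\<Sum>j\<in>{1..n}. row_mult n w Y j) / real n)"
    by (simp add: xP)
  then have "L2_set (\<lambda>j. row_mult n x (kernel_P n B) j - (\<Sum>i\<in>{1..n}. x i) / real n) {1..n}
      \<le> L2_set (row_mult n w Y) {1..n}"
    using L2_set_centred_le[OF n_pos, of "row_mult n w Y"] by simp
  also have "\<dots> \<le> \<delta> * real n * L2_set w {1..n}" by (rule Y_bound)
  also have "\<dots> \<le> \<delta> * real n * (L2_set x {1..n} / (c * real n))"
    using L2_set_div_S_le[of x] \<delta>_nonneg unfolding w_def by (intro mult_left_mono) auto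
  also have "\<dots> = \<delta> / c * L2_set x {1..n}" using n_pos by (simp add: field_simps)
  finally show ?thesis .
qed

lemma kernel_contraction:
  assumes "(\<Sum>i\<in>{1..n}. x i) = 0"
  shows "L2_set (row_mult n x (kernel_P n B)) {1..n} \<le> 1 / 2 * L2_set x {1..n}"
proof -
  have "\<delta> / c \<le> 1 / 2" using \<delta>_small c_pos by (simp add: field_simps)
  then have "\<delta> / c * L2_set x {1..n} \<le> 1 / 2 * L2_set x {1..n}"
    by (intro mult_right_mono) auto
  moreover have "L2_set (row_mult n x (kernel_P n B)) {1..n} \<le> \<delta> / c * L2_set x {1..n}"
    using kernel_centred_le[of x] unfolding assms by simp
  ultimately show ?thesis by (rule order_trans[rotated])
qed

lemma row_mult_diff: "row_mult n (\<lambda>i. x i - y i) K j = row_mult n x K j - row_mult n y K j"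
  by (simp add: row_mult_def algebra_simps sum_subtractf)

lemma kernel_invariant_unique:
  assumes p: "prob_vector n p" "\<forall>j\<in>{1..n}. row_mult n p (kernel_P n B) j = p j"
    and q: "prob_vector n q" "\<forall>j\<in>{1..n}. row_mult n q (kernel_P n B) j = q j"
  shows "p = q"
proof -
  define d where "d = (\<lambda>i. p i - q i)"
  have "(\<Sum>i\<in>{1..n}. d i) = 0"
    using p q by (simp add: d_def sum_subtractf prob_vector_def)
  from kernel_contraction[OF this]
  have "L2_set (row_mult n d (kernel_P n B)) {1..n} \<le> 1 / 2 * L2_set d {1..n}" .
  moreover have "L2_set (row_mult n d (kernel_P n B)) {1..n} = L2_set d {1..n}"
    using p q by (intro L2_set_cong) (auto simp: d_def row_mult_diff)
  ultimately have "L2_set d {1..n} = 0"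
    using L2_set_nonneg[of d "{1..n}"] by linarith
  then have "p i = q i" if "i \<in> {1..n}" for i
    using that by (simp add: L2_set_eq_0_iff d_def)
  moreover have "p i = q i" if "i \<notin> {1..n}" for i
    using p(1) q(1) that unfolding prob_vector_def by metis
  ultimately show ?thesis by blast
qed

text \<open>
  Iterating \<open>P\<close> from the uniform vector, consecutive differences have total mass zero and decay
  geometrically, so the iterates converge entrywise; nonnegativity and total mass pass to the limit.
\<close>

lemma kernel_invariant_exists:
  "\<exists>p. prob_vector n p \<and> (\<forall>j\<in>{1..n}. row_mult n p (kernel_P n B) j = p j)"
proof -
  define P where "P = kernel_P n B"
  define v where "v k = ((\<lambda>x. row_mult n x P) ^^ k) (\<lambda>_. 1 / real n)" for k
  have v_Suc: "v (Suc k) = row_mult n (v k) P" for k by (simp add: v_def)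
  define d where "d k = (\<lambda>j. v (Suc k) j - v k j)" for k
  have d_Suc: "d (Suc k) = row_mult n (d k) P" for k
    by (auto simp: d_def v_Suc row_mult_diff)
  have sum_v: "(\<Sum>j\<in>{1..n}. v k j) = 1" for k
  proof (induction k)
    case 0
    then show ?case using n_pos by (simp add: v_def)
  next
    case (Suc k)
    then show ?case unfolding v_Suc P_def sum_row_mult_kernel .
  qed
  have P_nonneg: "0 \<le> P i j" if "i \<in> {1..n}" "j \<in> {1..n}" for i j
    using that nonneg S_pos[of i] by (simp add: P_def kernel_P_def S_def)
  have v_nonneg: "0 \<le> v k j" if "j \<in> {1..n}" for k j
    using that
  proof (induction k arbitrary: j)
    case (Suc k)
    then show ?case unfolding v_Suc row_mult_def
      by (intro sum_nonneg mult_nonneg_nonneg P_nonneg) auto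
  qed (simp add: v_def)
  have d_le: "L2_set (d k) {1..n} \<le> (1 / 2) ^ k * L2_set (d 0) {1..n}" for k
  proof (induction k)
    case (Suc k)
    have "L2_set (d (Suc k)) {1..n} \<le> 1 / 2 * L2_set (d k) {1..n}"
      unfolding d_Suc P_def
      by (rule kernel_contraction) (simp only: d_def sum_subtractf sum_v diff_self)
    with Suc show ?case by simp
  qed simp
  have conv: "convergent (\<lambda>k. v k j)" if j: "j \<in> {1..n}" for j
  proof -
    have "summable (\<lambda>k. d k j)"
    proof (rule summable_comparison_test)
      show "summable (\<lambda>k. (1 / 2) ^ k * L2_set (d 0) {1..n})"
        by (intro summable_mult2 summable_geometric) simp
      have "\<bar>d k j\<bar> \<le> L2_set (\<lambda>j. \<bar>d k j\<bar>) {1..n}" for k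
        using j by (intro member_le_L2_set) auto
      then have "norm (d k j) \<le> (1 / 2) ^ k * L2_set (d 0) {1..n}" for k
        using order_trans[OF _ d_le[of k]] by (simp add: L2_set_def)
      then show "\<exists>N. \<forall>k\<ge>N. norm (d k j) \<le> (1 / 2) ^ k * L2_set (d 0) {1..n}" by blast
    qed
    then have "convergent (\<lambda>k. \<Sum>i<k. d i j)" by (simp add: summable_iff_convergent)
    then have "convergent (\<lambda>k. v k j - v 0 j)"
      by (simp add: d_def sum_lessThan_telescope[of "\<lambda>k. v k j"])
    from convergent_add[OF this convergent_const[of "v 0 j"]] show ?thesis by simp
  qed
  define p where "p j = (if j \<in> {1..n} then lim (\<lambda>k. v k j) else 0)" for j
  have lim: "(\<lambda>k. v k j) \<longlonglongrightarrow> p j" if "j \<in> {1..n}" for j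
    using conv[OF that] that by (simp add: p_def convergent_LIMSEQ_iff)
  have "(\<lambda>k. \<Sum>j\<in>{1..n}. v k j) \<longlonglongrightarrow> (\<Sum>j\<in>{1..n}. p j)"
    by (intro tendsto_sum lim)
  then have "(\<Sum>j\<in>{1..n}. p j) = 1"
    by (simp only: sum_v LIMSEQ_const_iff)
  moreover have "0 \<le> p j" if "j \<in> {1..n}" for j
    using lim[OF that] v_nonneg[OF that] by (intro LIMSEQ_le_const) auto
  ultimately have "prob_vector n p" by (auto simp: prob_vector_def p_def)
  moreover have "row_mult n p P j = p j" if j: "j \<in> {1..n}" for j
  proof (rule LIMSEQ_unique)
    show "(\<lambda>k. v (Suc k) j) \<longlonglongrightarrow> row_mult n p P j"
      unfolding v_Suc row_mult_def by (intro tendsto_intros lim)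
    show "(\<lambda>k. v (Suc k) j) \<longlonglongrightarrow> p j" by (rule LIMSEQ_Suc[OF lim[OF j]])
  qed
  ultimately show ?thesis by (auto simp: P_def)
qed

lemma kernel_invariant_props:
  "prob_vector n (kernel_invariant n (kernel_P n B))"
  "\<And>j. j \<in> {1..n} \<Longrightarrow> row_mult n (kernel_invariant n (kernel_P n B)) (kernel_P n B) j
     = kernel_invariant n (kernel_P n B) j"
proof -
  have "\<exists>!p. prob_vector n p \<and> (\<forall>j\<in>{1..n}. row_mult n p (kernel_P n B) j = p j)"
    using kernel_invariant_exists kernel_invariant_unique by blast
  from theI'[OF this]
  show "prob_vector n (kernel_invariant n (kernel_P n B))"
    "\<And>j. j \<in> {1..n} \<Longrightarrow> row_mult n (kernel_invariant n (kernel_P n B)) (kernel_P n B) j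
     = kernel_invariant n (kernel_P n B) j"
    unfolding kernel_invariant_def by blast+
qed

lemma tv_norm_le: "tv_norm n x \<le> 1 / 2 * (sqrt (real n) * L2_set x {1..n})"
  using sum_abs_le_L2_set[of x n] by (simp add: tv_norm_def)

lemma tv_norm_cong: "(\<And>i. i \<in> {1..n} \<Longrightarrow> x i = y i) \<Longrightarrow> tv_norm n x = tv_norm n y"
  by (simp add: tv_norm_def)

lemma L2_set_uniform: "L2_set (\<lambda>i. 1 / real n) {1..n} = 1 / sqrt (real n)"
proof -
  have "L2_set (\<lambda>i. 1 / real n) {1..n} = sqrt (real n) / real n" by (simp add: L2_set_constant)
  also have "\<dots> = 1 / sqrt (real n)"
    using n_pos by (simp add: real_div_sqrt real_sqrt_divide field_simps)
  finally show ?thesis .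
qed

text \<open>
  As \<open>\<pi> P = \<pi>\<close>, the central estimate bounds \<open>\<pi> - u\<close> by \<open>\<pi>\<close> itself. The factor being at most one
  half, this first gives the a priori bound \<open>2 / sqrt n\<close> on the norm of \<open>\<pi>\<close> and then, inserted again,
  the smallness of the difference.
\<close>

theorem tv_norm_kernel_invariant:
  "tv_norm n (\<lambda>i. kernel_invariant n (kernel_P n B) i - uniform_vector n i) \<le> \<delta> / c"
proof -
  define p where "p = kernel_invariant n (kernel_P n B)"
  define r where "r = (\<lambda>i. p i - 1 / real n)"
  have prob: "prob_vector n p" and inv: "\<And>j. j \<in> {1..n} \<Longrightarrow> row_mult n p (kernel_P n B) j = p j"
    using kernel_invariant_props unfolding p_def by auto
  have sum_p: "(\<Sum>i\<in>{1..n}. p i) = 1" using prob by (simp add: prob_vector_def)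
  have "L2_set r {1..n}
      = L2_set (\<lambda>j. row_mult n p (kernel_P n B) j - (\<Sum>i\<in>{1..n}. p i) / real n) {1..n}"
    unfolding sum_p by (intro L2_set_cong) (auto simp: r_def inv)
  also have "\<dots> \<le> \<delta> / c * L2_set p {1..n}" by (rule kernel_centred_le)
  finally have r_le: "L2_set r {1..n} \<le> \<delta> / c * L2_set p {1..n}" .
  have "L2_set p {1..n} = L2_set (\<lambda>i. r i + 1 / real n) {1..n}" by (simp add: r_def)
  also have "\<dots> \<le> L2_set r {1..n} + 1 / sqrt (real n)"
    using L2_set_triangle_ineq[of r "\<lambda>i. 1 / real n" "{1..n}"] unfolding L2_set_uniform .
  also have "L2_set r {1..n} \<le> 1 / 2 * L2_set p {1..n}"
  proof -
    have "\<delta> / c \<le> 1 / 2" using \<delta>_small c_pos by (simp add: field_simps)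
    then have "\<delta> / c * L2_set p {1..n} \<le> 1 / 2 * L2_set p {1..n}"
      by (intro mult_right_mono) auto
    with r_le show ?thesis by linarith
  qed
  finally have p_le: "L2_set p {1..n} \<le> 2 / sqrt (real n)" by simp
  have "tv_norm n (\<lambda>i. p i - uniform_vector n i) = tv_norm n r"
    by (intro tv_norm_cong) (simp add: r_def uniform_vector_def)
  also have "\<dots> \<le> 1 / 2 * (sqrt (real n) * L2_set r {1..n})" by (rule tv_norm_le)
  also have "\<dots> \<le> 1 / 2 * (sqrt (real n) * (\<delta> / c * (2 / sqrt (real n))))"
  proof -
    have "\<delta> / c * L2_set p {1..n} \<le> \<delta> / c * (2 / sqrt (real n))"
      using p_le \<delta>_nonneg c_pos by (intro mult_left_mono) auto
    with r_le show ?thesis by (intro mult_left_mono) auto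
  qed
  also have "\<dots> = \<delta> / c" using n_pos by simp
  finally show ?thesis by (simp add: p_def)
qed

lemma row_mult_generator:
  assumes "j \<in> {1..n}"
  shows "row_mult n p (generator_Q n B) j = row_mult n p B j - p j * S j"
  unfolding S_def using assms by (rule row_mult_generator_Q)

text \<open>
  The balance equation reads \<open>\<pi>\<^sub>j S\<^sub>j = m + (\<pi> Y)\<^sub>j\<close>. On the left the norm is at least
  \<open>c n\<close> times that of \<open>\<pi>\<close>, while \<open>\<pi> Y\<close> contributes at most half of this and can be absorbed.
\<close>

lemma generator_invariant_norm_le:
  assumes "prob_vector n p" "\<And>j. j \<in> {1..n} \<Longrightarrow> row_mult n p (generator_Q n B) j = 0"
  shows "L2_set p {1..n} \<le> 2 * \<bar>m\<bar> / (c * sqrt (real n))"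
proof -
  have bal: "p j * S j = m + row_mult n p Y j" if "j \<in> {1..n}" for j
    using assms that row_mult_generator[OF that, of p]
    by (simp add: row_mult_B prob_vector_def)
  have "c * real n * L2_set p {1..n} = L2_set (\<lambda>j. c * real n * p j) {1..n}"
    using cn_pos by (intro L2_set_right_distrib) simp
  also have "\<dots> \<le> L2_set (\<lambda>j. p j * S j) {1..n}"
  proof (rule L2_set_mono)
    fix j assume j: "j \<in> {1..n}"
    then have "0 \<le> p j" using assms(1) by (auto simp: prob_vector_def)
    then show "c * real n * p j \<le> p j * S j" "0 \<le> c * real n * p j"
      using S_ge[OF j] cn_pos by (simp_all add: mult.commute[of "p j"] mult_right_mono)
  qed
  also have "\<dots> = L2_set (\<lambda>j. m + row_mult n p Y j) {1..n}"
    by (intro L2_set_cong refl bal)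
  also have "\<dots> \<le> sqrt (real n) * \<bar>m\<bar> + L2_set (row_mult n p Y) {1..n}"
    using L2_set_triangle_ineq[of "\<lambda>_. m" "row_mult n p Y" "{1..n}"]
    by (simp add: L2_set_constant)
  also have "L2_set (row_mult n p Y) {1..n} \<le> c / 2 * real n * L2_set p {1..n}"
    using \<delta>_small by (intro order_trans[OF Y_bound] mult_right_mono) auto
  finally have "c * real n * L2_set p {1..n} \<le> 2 * (sqrt (real n) * \<bar>m\<bar>)"
    by simp
  also have "\<dots> = c * real n * (2 * \<bar>m\<bar> / (c * sqrt (real n)))"
  proof -
    have "sqrt (real n) = real n / sqrt (real n)" by (simp add: real_div_sqrt)
    then have "2 * (sqrt (real n) * \<bar>m\<bar>) = 2 * ((real n / sqrt (real n)) * \<bar>m\<bar>)" by metis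
    then show ?thesis using c_pos by simp
  qed
  finally show ?thesis using cn_pos by (rule mult_left_le_imp_le)
qed

lemma generator_invariant_unique:
  assumes p: "prob_vector n p" "\<forall>j\<in>{1..n}. row_mult n p (generator_Q n B) j = 0"
    and q: "prob_vector n q" "\<forall>j\<in>{1..n}. row_mult n q (generator_Q n B) j = 0"
  shows "p = q"
proof -
  define d where "d = (\<lambda>i. p i - q i)"
  have sum_d: "(\<Sum>i\<in>{1..n}. d i) = 0"
    using p q by (simp add: d_def sum_subtractf prob_vector_def)
  have "d j * S j = row_mult n d Y j" if "j \<in> {1..n}" for j
  proof -
    have "row_mult n p B j = p j * S j" "row_mult n q B j = q j * S j"
      using p(2) q(2) that row_mult_generator[OF that] by fastforce+
    then have "row_mult n d B j = d j * S j"
      by (simp add: d_def row_mult_diff left_diff_distrib)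
    then show ?thesis using row_mult_B[of d j] unfolding sum_d by simp
  qed
  then have "d j = row_mult n d Y j / S j" if "j \<in> {1..n}" for j
    using that S_pos[of j] by (simp add: field_simps)
  then have "L2_set d {1..n} = L2_set (\<lambda>j. row_mult n d Y j / S j) {1..n}"
    by (intro L2_set_cong) auto
  also have "\<dots> \<le> L2_set (row_mult n d Y) {1..n} / (c * real n)"
    by (rule L2_set_div_S_le)
  also have "\<dots> \<le> (\<delta> * real n * L2_set d {1..n}) / (c * real n)"
    using cn_pos by (intro divide_right_mono Y_bound) simp
  also have "\<dots> = \<delta> / c * L2_set d {1..n}" using n_pos by simp
  also have "\<dots> \<le> 1 / 2 * L2_set d {1..n}"
    using \<delta>_small c_pos by (intro mult_right_mono) (auto simp: field_simps)
  finally have "L2_set d {1..n} = 0"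
    using L2_set_nonneg[of d "{1..n}"] by linarith
  then have "p i = q i" if "i \<in> {1..n}" for i
    using that by (simp add: L2_set_eq_0_iff d_def)
  moreover have "p i = q i" if "i \<notin> {1..n}" for i
    using p(1) q(1) that unfolding prob_vector_def by metis
  ultimately show ?thesis by blast
qed

text \<open>
  An invariant vector \<open>r\<close> of the jump kernel is turned into one of the generator by weighting with
  the mean holding times \<open>1 / S\<^sub>i\<close>.
\<close>

lemma generator_invariant_exists:
  "\<exists>p. prob_vector n p \<and> (\<forall>j\<in>{1..n}. row_mult n p (generator_Q n B) j = 0)"
proof -
  obtain r where r: "prob_vector n r" "\<And>j. j \<in> {1..n} \<Longrightarrow> row_mult n r (kernel_P n B) j = r j"
    using kernel_invariant_exists by blast
  define w where "w i = r i / S i" for i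
  define W where "W = (\<Sum>i\<in>{1..n}. w i)"
  have w_nonneg: "0 \<le> w i" if "i \<in> {1..n}" for i
    using r(1) S_pos[OF that] that by (auto simp: w_def prob_vector_def)
  have "W \<noteq> 0"
  proof
    assume "W = 0"
    then have "\<forall>i\<in>{1..n}. w i = 0"
      unfolding W_def using w_nonneg by (subst (asm) sum_nonneg_eq_0_iff) auto
    then have "\<forall>i\<in>{1..n}. r i = 0" using S_pos by (force simp: w_def)
    then have "(\<Sum>i\<in>{1..n}. r i) = 0" by simp
    with r(1) show False by (simp add: prob_vector_def)
  qed
  moreover have "0 \<le> W" unfolding W_def by (intro sum_nonneg w_nonneg)
  ultimately have W: "0 < W" by simp
  have "prob_vector n (\<lambda>i. w i / W)"
    unfolding prob_vector_def
  proof (intro conjI ballI allI impI)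
    show "(\<Sum>i\<in>{1..n}. w i / W) = 1"
      using W by (simp add: W_def flip: sum_divide_distrib)
    show "0 \<le> w i / W" if "i \<in> {1..n}" for i using w_nonneg[OF that] W by simp
    show "w i / W = 0" if "i \<notin> {1..n}" for i
      using r(1) that unfolding prob_vector_def w_def by simp
  qed
  moreover have "row_mult n (\<lambda>i. w i / W) (generator_Q n B) j = 0" if j: "j \<in> {1..n}" for j
  proof -
    have "row_mult n (\<lambda>i. w i / W) B j = row_mult n w B j / W"
      by (simp add: row_mult_def sum_divide_distrib)
    also have "row_mult n w B j = r j"
      using r(2)[OF j] by (simp add: row_mult_kernel w_def[abs_def])
    also have "r j = w j * S j" using S_pos[OF j] by (simp add: w_def)
    finally show ?thesis by (simp add: row_mult_generator[OF j])
  qed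
  ultimately show ?thesis by blast
qed

text \<open>
  The assumed bound concerns multiplication by row vectors, but row sums of \<open>Y\<close> are a column
  operation. Pairing them with their signs \<open>\<epsilon>\<close> rewrites the sum as the total mass of \<open>\<epsilon> Y\<close>.
\<close>

lemma sum_row_deviation_le:
  "(\<Sum>i\<in>{1..n}. \<bar>S i - m * real n\<bar>) \<le> \<delta> * (real n)\<^sup>2"
proof -
  define \<epsilon> where "\<epsilon> i = sgn (S i - m * real n)" for i
  have S_eq: "S i - m * real n = (\<Sum>j\<in>{1..n}. Y i j)" for i
    by (simp add: S_def Y_def sum_subtractf)
  have "(\<Sum>i\<in>{1..n}. \<bar>S i - m * real n\<bar>) = (\<Sum>i\<in>{1..n}. \<Sum>j\<in>{1..n}. \<epsilon> i * Y i j)"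
    unfolding \<epsilon>_def unfolding sum_distrib_left[symmetric] S_eq[symmetric]
    by (simp only: abs_sgn mult.commute)
  also have "\<dots> = (\<Sum>j\<in>{1..n}. row_mult n \<epsilon> Y j)"
    unfolding row_mult_def by (rule sum.swap)
  also have "\<dots> \<le> (\<Sum>j\<in>{1..n}. \<bar>row_mult n \<epsilon> Y j\<bar>)"
    by (intro sum_mono) auto
  also have "\<dots> \<le> sqrt (real n) * L2_set (row_mult n \<epsilon> Y) {1..n}"
    by (rule sum_abs_le_L2_set)
  also have "\<dots> \<le> sqrt (real n) * (\<delta> * real n * L2_set \<epsilon> {1..n})"
    by (intro mult_left_mono Y_bound) auto
  also have "\<dots> \<le> sqrt (real n) * (\<delta> * real n * L2_set (\<lambda>_. 1) {1..n})"
    using \<delta>_nonneg by (intro mult_left_mono L2_set_mono_abs) (auto simp: \<epsilon>_def sgn_if)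
  also have "\<dots> = (sqrt (real n) * sqrt (real n)) * (\<delta> * real n)"
    by (simp add: L2_set_constant)
  also have "\<dots> = \<delta> * (real n)\<^sup>2" by (simp add: power2_eq_square)
  finally show ?thesis .
qed

text \<open>
  Solving the balance equation for \<open>\<pi>\<^sub>j - 1/n\<close> leaves two errors divided by \<open>S\<^sub>j \<ge> c n\<close>: the
  fluctuation \<open>(\<pi> Y)\<^sub>j\<close> and the deviation of \<open>S\<^sub>j\<close> from \<open>m n\<close>. Both are summed over \<open>j\<close>.
\<close>

theorem tv_norm_generator_invariant:
  "tv_norm n (\<lambda>i. generator_invariant n (generator_Q n B) i - uniform_vector n i)
     \<le> \<delta> * ((2 * \<bar>m\<bar> / c + 1) / c)"
proof -
  define p where "p = generator_invariant n (generator_Q n B)"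
  have "\<exists>!p. prob_vector n p \<and> (\<forall>j\<in>{1..n}. row_mult n p (generator_Q n B) j = 0)"
    using generator_invariant_exists generator_invariant_unique by blast
  from theI'[OF this]
  have prob: "prob_vector n p" and inv: "\<And>j. j \<in> {1..n} \<Longrightarrow> row_mult n p (generator_Q n B) j = 0"
    unfolding p_def generator_invariant_def by blast+
  define C where "C = 2 * \<bar>m\<bar> / c + 1"
  have pointwise: "\<bar>p j - 1 / real n\<bar>
      \<le> (\<bar>row_mult n p Y j\<bar> + \<bar>S j - m * real n\<bar> / real n) / (c * real n)"
    if j: "j \<in> {1..n}" for j
  proof -
    have "p j * S j = m + row_mult n p Y j"
      using inv[OF j] prob row_mult_generator[OF j, of p]
      by (simp add: row_mult_B prob_vector_def)
    then have "p j - 1 / real n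
        = (row_mult n p Y j - (S j - m * real n) / real n) / S j"
      using S_pos[OF j] n_pos by (simp add: field_simps)
    then have "\<bar>p j - 1 / real n\<bar>
        = \<bar>row_mult n p Y j - (S j - m * real n) / real n\<bar> / S j"
      using S_pos[OF j] by (simp add: abs_divide)
    also have "\<dots> \<le> \<bar>row_mult n p Y j - (S j - m * real n) / real n\<bar> / (c * real n)"
      using S_ge[OF j] S_pos[OF j] cn_pos by (intro divide_left_mono) auto
    also have "\<dots> \<le> (\<bar>row_mult n p Y j\<bar> + \<bar>(S j - m * real n) / real n\<bar>) / (c * real n)"
      using cn_pos by (intro divide_right_mono abs_triangle_ineq4) simp
    finally show ?thesis by (simp add: abs_divide)
  qed
  have "(\<Sum>j\<in>{1..n}. \<bar>row_mult n p Y j\<bar>) \<le> sqrt (real n) * L2_set (row_mult n p Y) {1..n}"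
    by (rule sum_abs_le_L2_set)
  also have "\<dots> \<le> sqrt (real n) * (\<delta> * real n * (2 * \<bar>m\<bar> / (c * sqrt (real n))))"
    using \<delta>_nonneg generator_invariant_norm_le[OF prob inv]
    by (intro mult_left_mono order_trans[OF Y_bound]) auto
  also have "\<dots> = \<delta> * real n * (2 * \<bar>m\<bar> / c)" using n_pos by simp
  finally have fluct: "(\<Sum>j\<in>{1..n}. \<bar>row_mult n p Y j\<bar>) \<le> \<delta> * real n * (2 * \<bar>m\<bar> / c)" .
  have "(\<Sum>j\<in>{1..n}. \<bar>S j - m * real n\<bar>) / real n \<le> \<delta> * (real n)\<^sup>2 / real n"
    by (intro divide_right_mono sum_row_deviation_le) simp
  then have rows: "(\<Sum>j\<in>{1..n}. \<bar>S j - m * real n\<bar>) / real n \<le> \<delta> * real n"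
    using n_pos by (simp add: power2_eq_square)
  have "(\<Sum>j\<in>{1..n}. \<bar>p j - 1 / real n\<bar>)
      \<le> (\<Sum>j\<in>{1..n}. (\<bar>row_mult n p Y j\<bar> + \<bar>S j - m * real n\<bar> / real n) / (c * real n))"
    by (intro sum_mono pointwise)
  also have "\<dots> = ((\<Sum>j\<in>{1..n}. \<bar>row_mult n p Y j\<bar>)
      + (\<Sum>j\<in>{1..n}. \<bar>S j - m * real n\<bar>) / real n) / (c * real n)"
    by (simp add: sum_divide_distrib sum.distrib add_divide_distrib)
  also have "\<dots> \<le> (\<delta> * real n * (2 * \<bar>m\<bar> / c) + \<delta> * real n) / (c * real n)"
    using cn_pos by (intro divide_right_mono add_mono fluct rows) simp
  also have "\<dots> = \<delta> * real n * C / (c * real n)" by (simp add: C_def distrib_left)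
  also have "\<dots> = \<delta> * (C / c)" using n_pos by simp
  finally have l1: "(\<Sum>j\<in>{1..n}. \<bar>p j - 1 / real n\<bar>) \<le> \<delta> * (C / c)" .
  have "0 \<le> (\<Sum>j\<in>{1..n}. \<bar>p j - 1 / real n\<bar>)" by (intro sum_nonneg) simp
  with l1 have "1 / 2 * (\<Sum>j\<in>{1..n}. \<bar>p j - 1 / real n\<bar>) \<le> \<delta> * (C / c)" by linarith
  moreover have "tv_norm n (\<lambda>i. p i - uniform_vector n i)
      = 1 / 2 * (\<Sum>j\<in>{1..n}. \<bar>p j - 1 / real n\<bar>)"
    by (simp add: tv_norm_def uniform_vector_def)
  ultimately show ?thesis unfolding p_def C_def by linarith
qed

end

section \<open>Corners of an asymptotically flat infinite array\<close>

locale asymptotically_flat_array =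
  fixes B :: "nat \<Rightarrow> nat \<Rightarrow> real" and m c :: real
  assumes c_pos: "0 < c"
    and nonneg: "\<And>i j. 1 \<le> i \<Longrightarrow> 1 \<le> j \<Longrightarrow> 0 \<le> B i j"
    and row_sums: "\<forall>\<^sub>F n in sequentially. \<forall>i\<in>{1..n}. c * real n \<le> (\<Sum>l\<in>{1..n}. B i l)"
    and deviation: "\<And>\<delta>. 0 < \<delta> \<Longrightarrow>
      \<forall>\<^sub>F n in sequentially. left_op_bound n (\<lambda>i j. B i j - m) (\<delta> * real n)"
begin

lemma eventually_nearly_flat_matrix:
  assumes "0 < \<delta>" "\<delta> \<le> c / 2"
  shows "\<forall>\<^sub>F n in sequentially. nearly_flat_matrix n B m c \<delta>"
  using row_sums deviation[OF assms(1)] eventually_ge_at_top[of 1]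
proof eventually_elim
  case (elim n)
  show ?case
    by standard (use elim assms c_pos nonneg in auto)
qed

lemma tv_norm_tendsto_0:
  assumes "\<And>n \<delta>. nearly_flat_matrix n B m c \<delta> \<Longrightarrow> tv_norm n (x n) \<le> \<delta> * D" "0 < D"
  shows "(\<lambda>n. tv_norm n (x n)) \<longlonglongrightarrow> 0"
proof (rule tendstoI)
  fix e :: real assume e: "0 < e"
  define \<delta> where "\<delta> = min (c / 2) (e / (2 * D))"
  have \<delta>: "0 < \<delta>" "\<delta> \<le> c / 2" using c_pos e assms(2) by (auto simp: \<delta>_def)
  have "\<delta> * D \<le> e / (2 * D) * D" using assms(2) by (intro mult_right_mono) (auto simp: \<delta>_def)
  also have "\<dots> < e" using e assms(2) by simp
  finally have small: "\<delta> * D < e" .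
  show "\<forall>\<^sub>F n in sequentially. dist (tv_norm n (x n)) 0 < e"
    using eventually_nearly_flat_matrix[OF \<delta>]
  proof eventually_elim
    case (elim n)
    have "0 \<le> tv_norm n (x n)" by (simp add: tv_norm_def sum_nonneg)
    with assms(1)[OF elim] small show ?case by simp
  qed
qed

theorem kernel_invariant_tendsto_uniform:
  "(\<lambda>n. tv_norm n (\<lambda>i. kernel_invariant n (kernel_P n B) i - uniform_vector n i)) \<longlonglongrightarrow> 0"
  by (rule tv_norm_tendsto_0[where D = "1 / c"])
    (use nearly_flat_matrix.tv_norm_kernel_invariant c_pos in auto)

theorem generator_invariant_tendsto_uniform:
  "(\<lambda>n. tv_norm n (\<lambda>i. generator_invariant n (generator_Q n B) i - uniform_vector n i))
     \<longlonglongrightarrow> 0"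
  by (rule tv_norm_tendsto_0[OF nearly_flat_matrix.tv_norm_generator_invariant])
    (use c_pos in \<open>auto intro!: divide_pos_pos add_nonneg_pos\<close>)

text \<open>
  A diagonal entry of \<open>B\<close> exceeds \<open>m\<close> by at most the operator norm of \<open>B - m\<close>, so the
  diagonal is of size \<open>o(n)\<close>, both as a diagonal matrix and as a correction to the row sums. Giving
  up half of \<open>c\<close> leaves room for it.
\<close>

lemma asymptotically_flat_zero_diagonal:
  "asymptotically_flat_array (\<lambda>i j. if i = j then 0 else B i j) m (c / 2)"
proof
  show "0 < c / 2" using c_pos by simp
  show "0 \<le> (if i = j then 0 else B i j)" if "1 \<le> i" "1 \<le> j" for i j
    using nonneg that by simp
  have large: "\<forall>\<^sub>F n in sequentially. \<bar>m\<bar> \<le> a * real n" if "0 < a" for a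
  proof -
    have "\<forall>\<^sub>F n in sequentially. \<bar>m\<bar> / a \<le> real n"
      using filterlim_real_sequentially unfolding filterlim_at_top by blast
    then show ?thesis by eventually_elim (use that in \<open>simp add: field_simps\<close>)
  qed
  have diag: "\<bar>B i i\<bar> \<le> \<bar>m\<bar> + \<delta> * real n"
    if "left_op_bound n (\<lambda>i j. B i j - m) (\<delta> * real n)" "i \<in> {1..n}" for n \<delta> i
    using left_op_bound_entry[OF that(1) that(2) that(2)] by linarith
  have "0 < c / 4" using c_pos by simp
  from row_sums deviation[OF this] large[OF this]
  show "\<forall>\<^sub>F n in sequentially. \<forall>i\<in>{1..n}.
      c / 2 * real n \<le> (\<Sum>l\<in>{1..n}. if i = l then 0 else B i l)"
  proof eventually_elim
    case (elim n)
    show ?case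
    proof
      fix i assume i: "i \<in> {1..n}"
      have "(\<Sum>l\<in>{1..n}. if i = l then 0 else B i l) = (\<Sum>l\<in>{1..n} - {i}. B i l)"
        by (intro sum.mono_neutral_cong_right) auto
      also have "\<dots> = (\<Sum>l\<in>{1..n}. B i l) - B i i"
        using i by (subst sum.remove[of "{1..n}" i]) auto
      moreover have "B i i \<le> c / 2 * real n"
        using diag[OF elim(2) i] elim(3) by linarith
      moreover have "c * real n \<le> (\<Sum>l\<in>{1..n}. B i l)" using elim(1) i by blast
      ultimately show "c / 2 * real n \<le> (\<Sum>l\<in>{1..n}. if i = l then 0 else B i l)" by linarith
    qed
  qed
  fix \<delta> :: real assume \<delta>: "0 < \<delta>"
  then have "0 < \<delta> / 3" by simp
  from deviation[OF this] large[OF this]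
  show "\<forall>\<^sub>F n in sequentially.
      left_op_bound n (\<lambda>i j. (if i = j then 0 else B i j) - m) (\<delta> * real n)"
  proof eventually_elim
    case (elim n)
    have "left_op_bound n (\<lambda>i j. if i = j then - B i i else 0) (2 * (\<delta> / 3 * real n))"
    proof (rule left_op_bound_diagonal)
      show "\<bar>- B i i\<bar> \<le> 2 * (\<delta> / 3 * real n)" if "i \<in> {1..n}" for i
        using diag[OF elim(1) that] elim(2) by simp
    qed (use \<delta> in simp)
    from left_op_bound_add[OF elim(1) this]
    have "left_op_bound n (\<lambda>i j. B i j - m + (if i = j then - B i i else 0)) (\<delta> * real n)"
      by (simp add: algebra_simps)
    moreover have "B i j - m + (if i = j then - B i i else 0) = (if i = j then 0 else B i j) - m"
      for i j by simp
    ultimately show ?case by simp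
  qed
qed

end

section \<open>Almost sure convergence and a dyadic moment bound\<close>

text \<open>
  The series of the \<open>Z k\<close> has finite expectation, hence converges almost everywhere. This replaces
  the combination of Markov's inequality with the first Borel-Cantelli lemma.
\<close>

lemma AE_tendsto_0_if_summable_integral:
  fixes Z :: "nat \<Rightarrow> 'a \<Rightarrow> real"
  assumes "\<And>k. integrable M (Z k)" "\<And>k x. 0 \<le> Z k x" "summable (\<lambda>k. \<integral>x. Z k x \<partial>M)"
  shows "AE x in M. (\<lambda>k. Z k x) \<longlonglongrightarrow> 0"
proof -
  have meas [measurable]: "Z k \<in> borel_measurable M" for k using assms(1) by auto
  have "(\<integral>\<^sup>+x. (\<Sum>k. ennreal (Z k x)) \<partial>M) = (\<Sum>k. \<integral>\<^sup>+x. ennreal (Z k x) \<partial>M)"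
    by (rule nn_integral_suminf) simp
  also have "\<dots> = (\<Sum>k. ennreal (\<integral>x. Z k x \<partial>M))"
    using assms(1,2) by (simp add: nn_integral_eq_integral)
  also have "\<dots> = ennreal (\<Sum>k. \<integral>x. Z k x \<partial>M)"
    using assms(2,3) by (intro suminf_ennreal2) (auto intro: integral_nonneg_AE)
  finally have "(\<integral>\<^sup>+x. (\<Sum>k. ennreal (Z k x)) \<partial>M) \<noteq> \<infinity>" by simp
  then have "AE x in M. (\<Sum>k. ennreal (Z k x)) \<noteq> \<infinity>"
    by (intro nn_integral_PInf_AE) simp
  then show ?thesis
  proof eventually_elim
    case (elim x)
    then have "summable (\<lambda>k. Z k x)"
      using assms(2) by (intro summable_suminf_not_top) (auto simp: infinity_ennreal_def)
    then show ?case by (rule summable_LIMSEQ_zero)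
  qed
qed

text \<open>
  The function \<open>4 y a / (a + y)\<close> of \<open>a\<close> increases from \<open>0\<close> to \<open>4 y\<close> and makes most of its growth
  where \<open>a\<close> is close to \<open>y\<close>. Its increment from \<open>a\<close> to \<open>4 a\<close> is \<open>12 a y\<^sup>2 / ((4 a + y) (a + y))\<close>, which
  dominates \<open>a\<close> below \<open>y\<close> and \<open>y\<^sup>2 / a\<close> above it; so the sum of minima over \<open>a = 4\<^sup>k\<close> telescopes.
\<close>

lemma min_le_dyadic_increment:
  fixes a y :: real
  assumes "0 < a" "0 \<le> y"
  shows "min a (y\<^sup>2 / a) \<le> 4 * y * (4 * a / (4 * a + y)) - 4 * y * (a / (a + y))"
proof -
  have pos: "0 < (4 * a + y) * (a + y)" using assms by (intro mult_pos_pos) auto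
  have incr: "4 * y * (4 * a / (4 * a + y)) - 4 * y * (a / (a + y))
      = 12 * (a * y\<^sup>2) / ((4 * a + y) * (a + y))"
    using assms by (simp add: divide_simps add_pos_nonneg) (simp add: algebra_simps power2_eq_square)
  show ?thesis
  proof (cases "a \<le> y")
    case True
    have "(4 * a + y) * (a + y) \<le> (5 * y) * (2 * y)" using True assms by (intro mult_mono) auto
    also have "\<dots> \<le> 12 * y\<^sup>2" by (simp add: power2_eq_square)
    finally have "a * ((4 * a + y) * (a + y)) \<le> a * (12 * y\<^sup>2)"
      using assms by (intro mult_left_mono) auto
    then have "a \<le> 12 * (a * y\<^sup>2) / ((4 * a + y) * (a + y))"
      using pos by (simp add: pos_le_divide_eq mult_ac)
    then show ?thesis unfolding incr by (rule min.coboundedI1)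
  next
    case False
    have "(4 * a + y) * (a + y) \<le> (5 * a) * (2 * a)" using False assms by (intro mult_mono) auto
    also have "\<dots> \<le> 12 * a\<^sup>2" using assms by (simp add: power2_eq_square)
    finally have "y\<^sup>2 / a * ((4 * a + y) * (a + y)) \<le> y\<^sup>2 / a * (12 * a\<^sup>2)"
      using assms by (intro mult_left_mono) auto
    also have "\<dots> = 12 * (a * y\<^sup>2)" using assms by (simp add: power2_eq_square)
    finally have "y\<^sup>2 / a \<le> 12 * (a * y\<^sup>2) / ((4 * a + y) * (a + y))"
      using pos by (simp add: pos_le_divide_eq)
    then show ?thesis unfolding incr by (rule min.coboundedI2)
  qed
qed

lemma sum_dyadic_min_le:
  fixes y :: real
  assumes "0 \<le> y"
  shows "(\<Sum>k<N. min (4 ^ k) (y\<^sup>2 / 4 ^ k)) \<le> 4 * y"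
proof -
  define F where "F k = 4 * y * (4 ^ k / (4 ^ k + y))" for k :: nat
  have "(\<Sum>k<N. min (4 ^ k) (y\<^sup>2 / 4 ^ k)) \<le> (\<Sum>k<N. F (Suc k) - F k)"
    unfolding F_def power_Suc using assms by (intro sum_mono min_le_dyadic_increment) auto
  also have "\<dots> = F N - F 0" by (rule sum_lessThan_telescope)
  also have "\<dots> \<le> F N" using assms by (simp add: F_def)
  also have "\<dots> \<le> 4 * y * 1"
    unfolding F_def using assms by (intro mult_left_mono) (auto simp: divide_le_eq_1 add_pos_nonneg)
  finally show ?thesis by simp
qed

section \<open>Arrays of independent, identically distributed variables\<close>

locale iid_array = prob_space M + law: prob_space L
  for M :: "'a measure" and L :: "real measure" +
  fixes X :: "nat \<Rightarrow> nat \<Rightarrow> 'a \<Rightarrow> real"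
  assumes indep: "indep_vars (\<lambda>_. borel) (\<lambda>(i, j). X i j) ({1..} \<times> {1..})"
    and distr_X: "\<And>i j. 1 \<le> i \<Longrightarrow> 1 \<le> j \<Longrightarrow> distr M borel (X i j) = L"
begin

lemma sets_L [measurable_cong, simp]: "sets L = sets borel"
  using distr_X[of 1 1] by (metis order_refl sets_distr)

lemma borel_measurable_L: "borel_measurable L = borel_measurable borel"
  by (rule measurable_cong_sets) auto

lemma measurable_X [measurable]: "1 \<le> i \<Longrightarrow> 1 \<le> j \<Longrightarrow> X i j \<in> borel_measurable M"
  using indep unfolding indep_vars_def by auto

lemma integrable_X:
  fixes f :: "real \<Rightarrow> real"
  assumes "1 \<le> i" "1 \<le> j" "integrable L f"
  shows "integrable M (\<lambda>\<omega>. f (X i j \<omega>))"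
proof -
  have "f \<in> borel_measurable borel" using assms(3) borel_measurable_L by auto
  with assms show ?thesis
    using integrable_distr_eq[of "X i j" M borel f] by (simp add: distr_X)
qed

lemma expectation_X:
  fixes f :: "real \<Rightarrow> real"
  assumes "1 \<le> i" "1 \<le> j" "integrable L f"
  shows "expectation (\<lambda>\<omega>. f (X i j \<omega>)) = law.expectation f"
proof -
  have "f \<in> borel_measurable borel" using assms(3) borel_measurable_L by auto
  with assms show ?thesis
    using integral_distr[of "X i j" M borel f] by (simp add: distr_X)
qed

lemma AE_all_entries:
  assumes "AE x in L. P x"
  shows "AE \<omega> in M. \<forall>i\<ge>1. \<forall>j\<ge>1. P (X i j \<omega>)"
proof -
  have "AE \<omega> in M. 1 \<le> i \<longrightarrow> 1 \<le> j \<longrightarrow> P (X i j \<omega>)" for i j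
  proof (cases "1 \<le> i \<and> 1 \<le> j")
    case True
    then have "AE x in distr M borel (X i j). P x" using assms by (subst distr_X) auto
    from AE_distrD[OF _ this] True show ?thesis by auto
  qed auto
  then have "AE \<omega> in M. \<forall>i j. 1 \<le> i \<longrightarrow> 1 \<le> j \<longrightarrow> P (X i j \<omega>)"
    unfolding AE_all_countable by blast
  then show ?thesis by eventually_elim blast
qed

lemma
  fixes f :: "nat \<times> nat \<Rightarrow> real \<Rightarrow> real"
  assumes I: "finite I" "I \<subseteq> {1..} \<times> {1..}" and f: "\<And>a. a \<in> I \<Longrightarrow> integrable L (f a)"
  shows integrable_prod_entries: "integrable M (\<lambda>\<omega>. \<Prod>a\<in>I. f a (X (fst a) (snd a) \<omega>))" (is ?int)
    and expectation_prod_entries: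
      "expectation (\<lambda>\<omega>. \<Prod>a\<in>I. f a (X (fst a) (snd a) \<omega>)) = (\<Prod>a\<in>I. law.expectation (f a))"
      (is ?exp)
proof -
  have "indep_vars (\<lambda>_. borel) (\<lambda>(i, j). X i j) I" by (rule indep_vars_subset[OF indep I(2)])
  from indep_vars_compose2[OF this, of f "\<lambda>_. borel"]
  have ind: "indep_vars (\<lambda>_. borel) (\<lambda>a \<omega>. f a (X (fst a) (snd a) \<omega>)) I"
    using f borel_measurable_L by (auto simp: case_prod_unfold)
  have int: "integrable M (\<lambda>\<omega>. f a (X (fst a) (snd a) \<omega>))" if "a \<in> I" for a
    using that I by (intro integrable_X f) auto
  show ?int by (rule indep_vars_integrable[OF I(1) ind int])
  have "expectation (\<lambda>\<omega>. \<Prod>a\<in>I. f a (X (fst a) (snd a) \<omega>))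
      = (\<Prod>a\<in>I. expectation (\<lambda>\<omega>. f a (X (fst a) (snd a) \<omega>)))"
    by (rule indep_vars_lebesgue_integral[OF I(1) ind int])
  also have "\<dots> = (\<Prod>a\<in>I. law.expectation (f a))"
    using I by (intro prod.cong refl expectation_X f) auto
  finally show ?exp .
qed

text \<open>
  The four entries sit at the corners of a rectangle of the array. If the rectangle is
  non-degenerate they are independent and the expectation vanishes; otherwise corners coincide in
  pairs, or all four do.
\<close>

lemma
  fixes f :: "real \<Rightarrow> real"
  assumes f [measurable]: "f \<in> borel_measurable borel" and bdd: "\<And>x. \<bar>f x\<bar> \<le> b"
    and mean: "law.expectation f = 0"
    and pos: "1 \<le> i" "1 \<le> i'" "1 \<le> j" "1 \<le> j'"
  shows integrable_rectangle: "integrable M (\<lambda>\<omega>.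
      f (X i j \<omega>) * f (X i' j \<omega>) * (f (X i j' \<omega>) * f (X i' j' \<omega>)))" (is "?int (i, i', j, j')")
    and expectation_rectangle: "expectation (\<lambda>\<omega>.
      f (X i j \<omega>) * f (X i' j \<omega>) * (f (X i j' \<omega>) * f (X i' j' \<omega>)))
    = (if i = i' then if j = j' then law.expectation (\<lambda>x. f x ^ 4)
         else (law.expectation (\<lambda>x. (f x)\<^sup>2))\<^sup>2
       else if j = j' then (law.expectation (\<lambda>x. (f x)\<^sup>2))\<^sup>2 else 0)"
proof -
  have int: "integrable L (\<lambda>x. f x ^ p)" for p
  proof (rule law.integrable_const_bound[of _ "b ^ p"])
    show "AE x in L. norm (f x ^ p) \<le> b ^ p"
      using bdd by (auto simp: power_abs intro!: power_mono)
  qed measurable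
  note prods = integrable_prod_entries expectation_prod_entries
  consider "i = i'" "j = j'" | "i = i'" "j \<noteq> j'" | "i \<noteq> i'" "j = j'" | "i \<noteq> i'" "j \<noteq> j'" by blast
  then have "?int (i, i', j, j') \<and> expectation (\<lambda>\<omega>.
      f (X i j \<omega>) * f (X i' j \<omega>) * (f (X i j' \<omega>) * f (X i' j' \<omega>)))
    = (if i = i' then if j = j' then law.expectation (\<lambda>x. f x ^ 4)
         else (law.expectation (\<lambda>x. (f x)\<^sup>2))\<^sup>2
       else if j = j' then (law.expectation (\<lambda>x. (f x)\<^sup>2))\<^sup>2 else 0)"
  proof cases
    case 1
    have "f (X i j \<omega>) * f (X i' j \<omega>) * (f (X i j' \<omega>) * f (X i' j' \<omega>)) = f (X i j \<omega>) ^ 4" for \<omega>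
      using 1 by (simp add: power4_eq_xxxx)
    then show ?thesis using 1 pos integrable_X[OF _ _ int] expectation_X[OF _ _ int] by simp
  next
    case 2
    then show ?thesis
      using prods[of "{(i, j), (i, j')}" "\<lambda>_ x. (f x)\<^sup>2"] pos int[of 2]
      by (simp add: power2_eq_square mult_ac)
  next
    case 3
    then show ?thesis
      using prods[of "{(i, j), (i', j)}" "\<lambda>_ x. (f x)\<^sup>2"] pos int[of 2]
      by (simp add: power2_eq_square mult_ac)
  next
    case 4
    then show ?thesis
      using prods[of "{(i, j), (i', j), (i, j'), (i', j')}" "\<lambda>_. f"] pos int[of 1] mean
      by (simp add: mult_ac)
  qed
  then show "?int (i, i', j, j')" and "expectation (\<lambda>\<omega>.
      f (X i j \<omega>) * f (X i' j \<omega>) * (f (X i j' \<omega>) * f (X i' j' \<omega>)))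
    = (if i = i' then if j = j' then law.expectation (\<lambda>x. f x ^ 4)
         else (law.expectation (\<lambda>x. (f x)\<^sup>2))\<^sup>2
       else if j = j' then (law.expectation (\<lambda>x. (f x)\<^sup>2))\<^sup>2 else 0)"
    by auto
qed

text \<open>
  The squared Frobenius norm of \<open>Z Z\<^sup>T\<close> for the \<open>n \<times> n\<close> matrix \<open>Z\<close> with entries \<open>f (X i j)\<close>.
\<close>

definition gram_norm :: "(real \<Rightarrow> real) \<Rightarrow> nat \<Rightarrow> 'a \<Rightarrow> real" where
  "gram_norm f n \<omega> =
     (\<Sum>i\<in>{1..n}. \<Sum>i'\<in>{1..n}. (\<Sum>j\<in>{1..n}. f (X i j \<omega>) * f (X i' j \<omega>))\<^sup>2)"

lemma gram_norm_nonneg: "0 \<le> gram_norm f n \<omega>"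
  unfolding gram_norm_def by (intro sum_nonneg) simp

text \<open>
  Expanding the square gives a sum over all rectangles. The degenerate ones number about \<open>2 n\<^sup>3\<close>,
  of which only the \<open>n\<^sup>2\<close> single points involve a fourth moment.
\<close>

lemma
  fixes f :: "real \<Rightarrow> real"
  assumes f: "f \<in> borel_measurable borel" "\<And>x. \<bar>f x\<bar> \<le> b" "law.expectation f = 0"
  shows integrable_gram_norm: "integrable M (gram_norm f n)"
    and expectation_gram_norm_le: "expectation (gram_norm f n)
      \<le> 2 * real n ^ 3 * (law.expectation (\<lambda>x. (f x)\<^sup>2))\<^sup>2
        + (real n)\<^sup>2 * law.expectation (\<lambda>x. f x ^ 4)"
proof -
  define s where "s = (law.expectation (\<lambda>x. (f x)\<^sup>2))\<^sup>2"
  define \<kappa> where "\<kappa> = law.expectation (\<lambda>x. f x ^ 4)"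
  let ?I = "{1..n}"
  have s: "0 \<le> s" by (simp add: s_def)
  have \<kappa>: "0 \<le> \<kappa>" unfolding \<kappa>_def by (intro integral_nonneg_AE) simp
  have expand: "gram_norm f n = (\<lambda>\<omega>. \<Sum>i\<in>?I. \<Sum>i'\<in>?I. \<Sum>j\<in>?I. \<Sum>j'\<in>?I.
      f (X i j \<omega>) * f (X i' j \<omega>) * (f (X i j' \<omega>) * f (X i' j' \<omega>)))"
    by (simp add: gram_norm_def fun_eq_iff power2_eq_square sum_product)
  have int: "integrable M (\<lambda>\<omega>.
      f (X i j \<omega>) * f (X i' j \<omega>) * (f (X i j' \<omega>) * f (X i' j' \<omega>)))"
    if "i \<in> ?I" "i' \<in> ?I" "j \<in> ?I" "j' \<in> ?I" for i i' j j'
    using that by (intro integrable_rectangle[OF f]) auto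
  show "integrable M (gram_norm f n)"
    unfolding expand by (intro Bochner_Integration.integrable_sum int)
  have "expectation (gram_norm f n) = (\<Sum>i\<in>?I. \<Sum>i'\<in>?I. \<Sum>j\<in>?I. \<Sum>j'\<in>?I. expectation (\<lambda>\<omega>.
      f (X i j \<omega>) * f (X i' j \<omega>) * (f (X i j' \<omega>) * f (X i' j' \<omega>))))"
    unfolding expand
    by (intro trans[OF Bochner_Integration.integral_sum] sum.cong refl
        Bochner_Integration.integrable_sum int)
  also have "\<dots> \<le> (\<Sum>i\<in>?I. \<Sum>i'\<in>?I. \<Sum>j\<in>?I. \<Sum>j'\<in>?I.
      (if i' = i then s else 0) + (if j' = j then s else 0)
      + (if i' = i then (if j' = j then \<kappa> else 0) else 0))"
  proof (intro sum_mono)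
    fix i i' j j' assume "i \<in> ?I" "i' \<in> ?I" "j \<in> ?I" "j' \<in> ?I"
    then show "expectation (\<lambda>\<omega>. f (X i j \<omega>) * f (X i' j \<omega>) * (f (X i j' \<omega>) * f (X i' j' \<omega>)))
      \<le> (if i' = i then s else 0) + (if j' = j then s else 0)
      + (if i' = i then (if j' = j then \<kappa> else 0) else 0)"
      using s \<kappa> by (subst expectation_rectangle[OF f]) (auto simp: s_def[symmetric] \<kappa>_def[symmetric])
  qed
  also have "\<dots> = 2 * real n ^ 3 * s + (real n)\<^sup>2 * \<kappa>"
  proof -
    have "(\<Sum>i'\<in>?I. \<Sum>j\<in>?I. \<Sum>j'\<in>?I. (if i' = i then s else 0) + (if j' = j then s else 0)
        + (if i' = i then (if j' = j then \<kappa> else 0) else 0))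
      = 2 * (real n)\<^sup>2 * s + real n * \<kappa>" if "i \<in> ?I" for i
    proof -
      have "(\<Sum>j\<in>?I. \<Sum>j'\<in>?I. (if i' = i then s else 0) + (if j' = j then s else 0)
        + (if i' = i then (if j' = j then \<kappa> else 0) else 0))
        = (if i' = i then (real n)\<^sup>2 * s + real n * \<kappa> else 0) + real n * s" for i'
        by (cases "i' = i") (simp_all add: sum.distrib sum.delta power2_eq_square algebra_simps)
      then show ?thesis using that
        by (simp add: sum.distrib sum.delta power2_eq_square algebra_simps)
    qed
    then show ?thesis by (simp add: power2_eq_square power3_eq_cube algebra_simps)
  qed
  finally show "expectation (gram_norm f n)
      \<le> 2 * real n ^ 3 * (law.expectation (\<lambda>x. (f x)\<^sup>2))\<^sup>2
        + (real n)\<^sup>2 * law.expectation (\<lambda>x. f x ^ 4)"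
    by (simp add: s_def \<kappa>_def)
qed

text \<open>
  At scale \<open>2\<^sup>k\<close> the entries are truncated at \<open>2\<^sup>k\<close> (\<open>t k\<close>, with mean \<open>a k\<close>) and centred (\<open>f k\<close>).
  Two sequences must tend to \<open>0\<close> almost surely: \<open>N k\<close>, the normalised Gram norm of the centred
  truncated corner, and \<open>C k\<close>, the number of truncated entries in the corner, which being an integer
  is then eventually \<open>0\<close>. Their expectations are controlled by the one summable sequence
  \<open>E (g k)\<close>: below the truncation level \<open>g k x\<close> is \<open>x\<^sup>4 / 4\<^sup>k\<close>, and above it \<open>4\<^sup>k\<close>. The corner
  of \<open>X - m\<close> then equals the centred truncated corner plus the constant \<open>a k - m\<close>, which tends
  to \<open>0\<close>.
\<close>

theorem centred_array_op_norm_is_o: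
  assumes sq: "integrable L (\<lambda>x. x\<^sup>2)"
  shows "AE \<omega> in M. \<forall>\<delta>>0. \<forall>\<^sub>F n in sequentially.
    left_op_bound n (\<lambda>i j. X i j \<omega> - law.expectation (\<lambda>x. x)) (\<delta> * real n)"
proof -
  define \<mu> where "\<mu> = law.expectation (\<lambda>x. x)"
  define \<nu> where "\<nu> = law.expectation (\<lambda>x. \<bar>x\<bar>)"
  define t where "t k x = (if \<bar>x\<bar> \<le> 2 ^ k then x else 0)" for k and x :: real
  define a where "a k = law.expectation (t k)" for k
  define f where "f k x = t k x - a k" for k x
  define g where "g k x = min (4 ^ k) ((x\<^sup>2)\<^sup>2 / 4 ^ k)" for k and x :: real
  have four: "(4::real) ^ k = (2 ^ k)\<^sup>2" for k by (simp add: power2_eq_square flip: power_mult_distrib)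
  have [measurable]: "t k \<in> borel_measurable borel" "f k \<in> borel_measurable borel"
    "g k \<in> borel_measurable borel" for k
    unfolding f_def t_def g_def by measurable
  have int_id: "integrable L (\<lambda>x. x)"
    by (rule law.square_integrable_imp_integrable[OF _ sq]) simp
  have int_abs: "integrable L (\<lambda>x. \<bar>x\<bar>)" using int_id by (rule integrable_abs)
  have t_bdd: "\<bar>t k x\<bar> \<le> 2 ^ k" for k x by (simp add: t_def)
  have t_abs: "\<bar>t k x\<bar> \<le> \<bar>x\<bar>" for k x by (simp add: t_def)
  have int_t: "integrable L (t k)" for k
    by (rule Bochner_Integration.integrable_bound[OF int_abs]) (auto simp: t_abs)
  have a_abs: "\<bar>a k\<bar> \<le> \<nu>" for k
    unfolding a_def \<nu>_def
    by (rule order_trans[OF integral_abs_bound]) (intro integral_mono int_abs integrable_abs int_t t_abs)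
  have \<nu>_nonneg: "0 \<le> \<nu>" using a_abs[of 0] by linarith
  have a_lim: "a \<longlonglongrightarrow> \<mu>"
    unfolding a_def \<mu>_def
  proof (rule integral_dominated_convergence[where w = "\<lambda>x. \<bar>x\<bar>"])
    show "AE x in L. (\<lambda>k. t k x) \<longlonglongrightarrow> x"
    proof (intro AE_I2 tendsto_eventually)
      fix x :: real
      obtain K where K: "\<bar>x\<bar> < 2 ^ K" using real_arch_pow[of 2 "\<bar>x\<bar>"] by auto
      show "\<forall>\<^sub>F k in sequentially. t k x = x"
        using eventually_ge_at_top[of K]
      proof eventually_elim
        case (elim k)
        then have "(2::real) ^ K \<le> 2 ^ k" by (intro power_increasing) auto
        then have "\<bar>x\<bar> \<le> 2 ^ k" using K by linarith
          then show ?case by (simp add: t_def)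
      qed
    qed
  qed (use int_abs t_abs in auto)
  have f_bdd: "\<bar>f k x\<bar> \<le> 2 ^ k + \<nu>" for k x
    using t_bdd[of k x] a_abs[of k] unfolding f_def by linarith
  have f_mean: "law.expectation (f k) = 0" for k
    using int_t by (simp add: f_def[abs_def] a_def law.prob_space)
  have int_f: "integrable L (\<lambda>x. f k x ^ p)" for k p
  proof (rule law.integrable_const_bound[of _ "(2 ^ k + \<nu>) ^ p"])
    show "AE x in L. norm (f k x ^ p) \<le> (2 ^ k + \<nu>) ^ p"
      using f_bdd by (auto simp: power_abs intro!: power_mono)
  qed measurable
  have int_g: "integrable L (g k)" for k
    by (rule law.integrable_const_bound[of _ "4 ^ k"]) (auto simp: g_def)
  have g_nonneg: "0 \<le> g k x" for k x by (simp add: g_def)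
  have summable_g: "summable (\<lambda>k. law.expectation (g k))"
  proof (rule summableI_nonneg_bounded)
    show "0 \<le> law.expectation (g k)" for k using g_nonneg by (intro integral_nonneg_AE) simp
    show "(\<Sum>k<N. law.expectation (g k)) \<le> law.expectation (\<lambda>x. 4 * x\<^sup>2)" for N
    proof -
      have "(\<Sum>k<N. law.expectation (g k)) = law.expectation (\<lambda>x. \<Sum>k<N. g k x)"
        using int_g by (simp add: Bochner_Integration.integral_sum)
      also have "\<dots> \<le> law.expectation (\<lambda>x. 4 * x\<^sup>2)"
        unfolding g_def using sq int_g[unfolded g_def]
        by (intro integral_mono sum_dyadic_min_le Bochner_Integration.integrable_sum) auto
      finally show ?thesis .
    qed
  qed
  define s where "s = 2 * law.expectation (\<lambda>x. x\<^sup>2) + 2 * \<nu>\<^sup>2"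
  have f_sq: "law.expectation (\<lambda>x. (f k x)\<^sup>2) \<le> s" for k
  proof -
    have "law.expectation (\<lambda>x. (f k x)\<^sup>2) \<le> law.expectation (\<lambda>x. 2 * x\<^sup>2 + 2 * \<nu>\<^sup>2)"
    proof (intro integral_mono int_f)
      fix x
      have "(f k x)\<^sup>2 \<le> 2 * (t k x)\<^sup>2 + 2 * (a k)\<^sup>2"
        using zero_le_power2[of "t k x + a k"] by (simp add: f_def power2_eq_square algebra_simps)
      moreover have "(t k x)\<^sup>2 \<le> x\<^sup>2" using t_abs by (simp add: abs_le_square_iff)
      moreover have "(a k)\<^sup>2 \<le> \<nu>\<^sup>2" using a_abs \<nu>_nonneg by (simp flip: abs_le_square_iff)
      ultimately show "(f k x)\<^sup>2 \<le> 2 * x\<^sup>2 + 2 * \<nu>\<^sup>2" by linarith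
    qed (use sq in simp)
    also have "\<dots> = s" using sq by (simp add: s_def law.prob_space)
    finally show ?thesis .
  qed
  have f_four: "law.expectation (\<lambda>x. f k x ^ 4) / 4 ^ k
      \<le> 8 * law.expectation (g k) + 8 * \<nu> ^ 4 * (1 / 4) ^ k" for k
  proof -
    have "law.expectation (\<lambda>x. f k x ^ 4) \<le> law.expectation (\<lambda>x. 8 * 4 ^ k * g k x + 8 * \<nu> ^ 4)"
    proof (intro integral_mono int_f)
      fix x
      have "(f k x)\<^sup>2 \<le> 2 * (t k x)\<^sup>2 + 2 * (a k)\<^sup>2"
        using zero_le_power2[of "t k x + a k"] by (simp add: f_def power2_eq_square algebra_simps)
      then have "((f k x)\<^sup>2)\<^sup>2 \<le> (2 * (t k x)\<^sup>2 + 2 * (a k)\<^sup>2)\<^sup>2" by (intro power_mono) auto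
      also have "\<dots> \<le> 8 * ((t k x)\<^sup>2)\<^sup>2 + 8 * ((a k)\<^sup>2)\<^sup>2"
        using zero_le_power2[of "(t k x)\<^sup>2 - (a k)\<^sup>2"]
        by (simp add: power2_eq_square algebra_simps)
      finally have "f k x ^ 4 \<le> 8 * ((t k x)\<^sup>2)\<^sup>2 + 8 * (a k) ^ 4" by (simp flip: power_mult)
      moreover have "((t k x)\<^sup>2)\<^sup>2 \<le> 4 ^ k * g k x"
      proof (cases "\<bar>x\<bar> \<le> 2 ^ k")
        case True
        then have "x\<^sup>2 \<le> 4 ^ k" unfolding four by (simp add: abs_le_square_iff[symmetric])
        then have "(x\<^sup>2)\<^sup>2 \<le> (4 ^ k)\<^sup>2" by (intro power_mono) auto
        then have "(x\<^sup>2)\<^sup>2 / 4 ^ k \<le> 4 ^ k" by (simp add: divide_le_eq power2_eq_square)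
        then show ?thesis using True by (simp add: t_def g_def)
      qed (simp add: t_def g_nonneg)
      moreover have "a k ^ 4 \<le> \<nu> ^ 4"
        using power_mono[OF a_abs[of k], of 4] by simp
      ultimately show "f k x ^ 4 \<le> 8 * 4 ^ k * g k x + 8 * \<nu> ^ 4" by linarith
    qed (use int_g in simp)
    also have "\<dots> = 8 * 4 ^ k * law.expectation (g k) + 8 * \<nu> ^ 4"
      using int_g by (simp add: law.prob_space)
    finally have "law.expectation (\<lambda>x. f k x ^ 4) / 4 ^ k
        \<le> (8 * 4 ^ k * law.expectation (g k) + 8 * \<nu> ^ 4) / 4 ^ k"
      by (intro divide_right_mono) auto
    also have "\<dots> = 8 * law.expectation (g k) + 8 * \<nu> ^ 4 * (1 / 4) ^ k"
      by (simp add: add_divide_distrib power_divide)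
    finally show ?thesis .
  qed
  define N where "N k \<omega> = gram_norm (f k) (2 ^ k) \<omega> / 16 ^ k" for k \<omega>
  have AE_N: "AE \<omega> in M. (\<lambda>k. N k \<omega>) \<longlonglongrightarrow> 0"
  proof (rule AE_tendsto_0_if_summable_integral)
    have gram: "integrable M (gram_norm (f k) n)" for k n
      by (rule integrable_gram_norm[OF _ f_bdd f_mean]) simp
    then show "integrable M (N k)" for k by (simp add: N_def[abs_def])
    show nonneg: "0 \<le> N k \<omega>" for k \<omega> by (simp add: N_def gram_norm_nonneg)
    have bound: "expectation (N k)
        \<le> 2 * s\<^sup>2 * (1 / 2) ^ k + (8 * law.expectation (g k) + 8 * \<nu> ^ 4 * (1 / 4) ^ k)" for k
    proof -
      have "expectation (gram_norm (f k) (2 ^ k))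
        \<le> 2 * real (2 ^ k) ^ 3 * (law.expectation (\<lambda>x. (f k x)\<^sup>2))\<^sup>2
        + (real (2 ^ k))\<^sup>2 * law.expectation (\<lambda>x. f k x ^ 4)"
        by (rule expectation_gram_norm_le[OF _ f_bdd f_mean]) simp
      also have "\<dots> \<le> 2 * real (2 ^ k) ^ 3 * s\<^sup>2 + (real (2 ^ k))\<^sup>2 * law.expectation (\<lambda>x. f k x ^ 4)"
        by (intro add_mono mult_left_mono power_mono f_sq integral_nonneg_AE) auto
      also have "\<dots> = 8 ^ k * (2 * s\<^sup>2) + 4 ^ k * law.expectation (\<lambda>x. f k x ^ 4)"
      proof -
        have "real (2 ^ k) ^ 3 = 8 ^ k" by (simp add: power3_eq_cube flip: power_mult_distrib)
        moreover have "(real (2 ^ k))\<^sup>2 = 4 ^ k" by (simp add: four)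
        ultimately show ?thesis by simp
      qed
      finally have "expectation (gram_norm (f k) (2 ^ k)) / 16 ^ k
          \<le> (8 ^ k * (2 * s\<^sup>2) + 4 ^ k * law.expectation (\<lambda>x. f k x ^ 4)) / 16 ^ k"
        by (intro divide_right_mono) auto
      also have "\<dots> = 2 * s\<^sup>2 * (8 ^ k / 16 ^ k) + law.expectation (\<lambda>x. f k x ^ 4) * (4 ^ k / 16 ^ k)"
        by (simp add: add_divide_distrib mult.commute)
      also have "(8::real) ^ k / 16 ^ k = (1 / 2) ^ k" by (simp flip: power_divide)
      also have "(4::real) ^ k / 16 ^ k = 1 / 4 ^ k" by (simp flip: power_divide) (simp add: power_divide)
      finally show ?thesis using f_four[of k] by (simp add: N_def[abs_def])
    qed
    show "summable (\<lambda>k. expectation (N k))"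
    proof (rule summable_comparison_test')
      show "summable (\<lambda>k. 2 * s\<^sup>2 * (1 / 2) ^ k + (8 * law.expectation (g k) + 8 * \<nu> ^ 4 * (1 / 4) ^ k))"
        by (intro summable_add summable_mult summable_g summable_geometric) auto
      fix k
      have "0 \<le> expectation (N k)" using nonneg by (intro integral_nonneg_AE) simp
      with bound[of k] show "norm (expectation (N k))
        \<le> 2 * s\<^sup>2 * (1 / 2) ^ k + (8 * law.expectation (g k) + 8 * \<nu> ^ 4 * (1 / 4) ^ k)" by simp
    qed
  qed
  define h where "h k x = (if \<bar>x\<bar> \<le> 2 ^ k then 0 else 1 :: real)" for k and x :: real
  have [measurable]: "h k \<in> borel_measurable borel" for k unfolding h_def by measurable
  define C where "C k \<omega> = (\<Sum>i\<in>{1..2 ^ k}. \<Sum>j\<in>{1..2 ^ k}. h k (X i j \<omega>))" for k \<omega>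
  have int_h: "integrable L (h k)" for k
    by (rule law.integrable_const_bound[of _ 1]) (auto simp: h_def)
  have h_le: "4 ^ k * law.expectation (h k) \<le> law.expectation (g k)" for k
  proof -
    have "4 ^ k * h k x \<le> g k x" for x
    proof (cases "\<bar>x\<bar> \<le> 2 ^ k")
      case False
      then have "4 ^ k \<le> x\<^sup>2" unfolding four by (simp add: abs_le_square_iff[symmetric])
      then have "(4 ^ k)\<^sup>2 \<le> (x\<^sup>2)\<^sup>2" by (intro power_mono) auto
      then have "4 ^ k \<le> (x\<^sup>2)\<^sup>2 / 4 ^ k" by (simp add: le_divide_eq power2_eq_square)
      then show ?thesis using False by (simp add: h_def g_def)
    qed (simp add: h_def g_nonneg)
    then have "law.expectation (\<lambda>x. 4 ^ k * h k x) \<le> law.expectation (g k)"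
      using int_h int_g by (intro integral_mono) auto
    then show ?thesis by simp
  qed
  have AE_C: "AE \<omega> in M. (\<lambda>k. C k \<omega>) \<longlonglongrightarrow> 0"
  proof (rule AE_tendsto_0_if_summable_integral)
    have int_hX: "integrable M (\<lambda>\<omega>. h k (X i j \<omega>))"
      "expectation (\<lambda>\<omega>. h k (X i j \<omega>)) = law.expectation (h k)"
      if "i \<in> {1..2 ^ k}" "j \<in> {1..2 ^ k}" for k i j
      using that by (auto intro!: integrable_X expectation_X int_h)
    show "integrable M (C k)" for k
      unfolding C_def[abs_def] by (intro Bochner_Integration.integrable_sum int_hX)
    show nonneg: "0 \<le> C k \<omega>" for k \<omega> by (auto simp: C_def h_def intro!: sum_nonneg)
    have C_exp: "expectation (C k) = 4 ^ k * law.expectation (h k)" for k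
    proof -
      have "expectation (C k) = (\<Sum>i\<in>{1..2 ^ k::nat}. \<Sum>j\<in>{1..2 ^ k::nat}. law.expectation (h k))"
        unfolding C_def[abs_def]
        by (intro trans[OF Bochner_Integration.integral_sum] sum.cong refl
            Bochner_Integration.integrable_sum int_hX)
      also have "\<dots> = 4 ^ k * law.expectation (h k)" by (simp add: four power2_eq_square)
      finally show ?thesis .
    qed
    show "summable (\<lambda>k. expectation (C k))"
    proof (rule summable_comparison_test'[OF summable_g])
      fix k
      have "0 \<le> expectation (C k)" using nonneg by (intro integral_nonneg_AE) simp
      then show "norm (expectation (C k)) \<le> law.expectation (g k)"
        using h_le[of k] by (simp add: C_exp)
    qed
  qed
  from AE_N AE_C show ?thesis
    unfolding \<mu>_def[symmetric]
  proof eventually_elim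
    case (elim \<omega>)
    show ?case
    proof (intro allI impI)
      fix \<delta> :: real assume \<delta>: "0 < \<delta>"
      \<comment> \<open>A factor \<open>2\<close> is lost to the two summands below and another one to rounding \<open>n\<close> up to a power of \<open>2\<close>.\<close>
      define \<eta> where "\<eta> = \<delta> / 4"
      have \<eta>: "0 < \<eta>" using \<delta> by (simp add: \<eta>_def)
      have "\<forall>\<^sub>F k in sequentially. N k \<omega> < \<eta> ^ 4" "\<forall>\<^sub>F k in sequentially. C k \<omega> < 1"
        "\<forall>\<^sub>F k in sequentially. dist (a k) \<mu> < \<eta>"
        using \<eta> by (auto intro: order_tendstoD(2)[OF elim(1)] order_tendstoD(2)[OF elim(2)]
            tendstoD[OF a_lim])
      then have "\<forall>\<^sub>F k in sequentially. left_op_bound (2 ^ k) (\<lambda>i j. X i j \<omega> - \<mu>) (2 * \<eta> * 2 ^ k)"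
      proof eventually_elim
        case (elim k)
        have trunc: "t k (X i j \<omega>) = X i j \<omega>" if "i \<in> {1..2 ^ k}" "j \<in> {1..2 ^ k}" for i j
        proof (rule ccontr)
          assume "t k (X i j \<omega>) \<noteq> X i j \<omega>"
          then have "1 = h k (X i j \<omega>)" by (auto simp: t_def h_def split: if_splits)
          also have "\<dots> \<le> (\<Sum>j\<in>{1..2 ^ k}. h k (X i j \<omega>))"
            using that by (intro member_le_sum) (auto simp: h_def)
          also have "\<dots> \<le> C k \<omega>"
            unfolding C_def using that by (intro member_le_sum) (auto simp: h_def intro!: sum_nonneg)
          finally show False using elim(2) by simp
        qed
        have "gram_norm (f k) (2 ^ k) \<omega> \<le> \<eta> ^ 4 * 16 ^ k"
          using elim(1) by (simp add: N_def divide_less_eq)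
        also have "16 ^ k = (2 ^ k :: real) ^ 4"
          by (simp add: power4_eq_xxxx flip: power_mult_distrib)
        also have "\<eta> ^ 4 * (2 ^ k) ^ 4 = (\<eta> * 2 ^ k) ^ 4" by (simp only: power_mult_distrib)
        finally have "left_op_bound (2 ^ k) (\<lambda>i j. f k (X i j \<omega>)) (\<eta> * 2 ^ k)"
          using \<eta> unfolding gram_norm_def by (intro left_op_bound_gram) auto
        moreover have "left_op_bound (2 ^ k) (\<lambda>i j. a k - \<mu>) (\<eta> * 2 ^ k)"
          using elim(3) by (intro left_op_bound_weaken[OF left_op_bound_const])
            (simp add: dist_real_def mult.commute)
        ultimately have "left_op_bound (2 ^ k) (\<lambda>i j. f k (X i j \<omega>) + (a k - \<mu>))
            (\<eta> * 2 ^ k + \<eta> * 2 ^ k)"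
          by (rule left_op_bound_add)
        then have "left_op_bound (2 ^ k) (\<lambda>i j. X i j \<omega> - \<mu>) (\<eta> * 2 ^ k + \<eta> * 2 ^ k)"
          by (subst left_op_bound_cong) (auto simp: f_def trunc)
        then show ?case by (simp add: mult.assoc)
      qed
      then obtain K where K: "\<And>k. K \<le> k \<Longrightarrow>
          left_op_bound (2 ^ k) (\<lambda>i j. X i j \<omega> - \<mu>) (2 * \<eta> * 2 ^ k)"
        by (auto simp: eventually_sequentially)
      show "\<forall>\<^sub>F n in sequentially. left_op_bound n (\<lambda>i j. X i j \<omega> - \<mu>) (\<delta> * real n)"
        using eventually_ge_at_top[of "2 ^ K"]
      proof eventually_elim
        case (elim n)
        then have "1 \<le> n" using one_le_power[of "2::nat" K] by linarith
        then obtain k where k: "2 ^ k \<le> n" "n < 2 ^ (k + 1)"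
          using ex_power_ivl1[of 2 n] by auto
        have "(2::nat) ^ K < 2 ^ (k + 1)" using elim k(2) by linarith
        then have "K < k + 1" by (rule power_less_imp_less_exp[rotated]) simp
        then have "left_op_bound n (\<lambda>i j. X i j \<omega> - \<mu>) (2 * \<eta> * 2 ^ (k + 1))"
          using k(2) by (intro left_op_bound_submatrix[OF K]) auto
        moreover have "2 * \<eta> * 2 ^ (k + 1) \<le> \<delta> * real n"
        proof -
          have "real (2 ^ k) \<le> real n" using k(1) by (simp only: of_nat_le_iff)
          then have "\<delta> * 2 ^ k \<le> \<delta> * real n" using \<delta> by (intro mult_left_mono) auto
          then show ?thesis by (simp add: \<eta>_def)
        qed
        ultimately show ?case by (rule left_op_bound_weaken)
      qed
    qed
  qed
qed

text \<open>
  If \<open>q = E exp (- X) < 1\<close>, Markov's inequality for \<open>exp (c n - S)\<close> bounds the probability that one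
  row sum falls below \<open>c n\<close> by \<open>(e\<^sup>c q)\<^sup>n\<close>. A union bound over the \<open>n\<close> rows remains summable as soon
  as \<open>e\<^sup>c q < 1\<close>.
\<close>

theorem row_sums_grow_linearly:
  assumes nonneg: "AE x in L. 0 \<le> x" and nonzero: "\<not> (AE x in L. x = 0)"
  shows "\<exists>c>0. AE \<omega> in M. \<forall>\<^sub>F n in sequentially. \<forall>i\<in>{1..n}.
    c * real n \<le> (\<Sum>l\<in>{1..n}. X i l \<omega>)"
proof -
  define q where "q = law.expectation (\<lambda>x. exp (- x))"
  have int: "integrable L (\<lambda>x. exp (- x))"
    by (rule law.integrable_const_bound[of _ 1]) (use nonneg in auto)
  have "0 \<le> q" unfolding q_def by (intro integral_nonneg_AE) simp
  have "q < 1"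
  proof (rule ccontr)
    assume "\<not> q < 1"
    have "law.expectation (\<lambda>x. 1 - exp (- x)) = 1 - q"
      using int by (simp add: q_def law.prob_space)
    moreover have "0 \<le> law.expectation (\<lambda>x. 1 - exp (- x))"
      using nonneg by (intro integral_nonneg_AE) auto
    ultimately have "law.expectation (\<lambda>x. 1 - exp (- x)) = 0" using \<open>\<not> q < 1\<close> by linarith
    then have "AE x in L. 1 - exp (- x) = 0"
      using nonneg int by (subst (asm) integral_nonneg_eq_0_iff_AE) auto
    with nonzero show False by simp
  qed
  \<comment> \<open>Any \<open>c\<close> with \<open>c > 0\<close> and \<open>e\<^sup>c q < 1\<close> would do; this choice remains meaningful for \<open>q = 0\<close>.\<close>
  define c where "c = ln (2 / (1 + q))"
  have c: "0 < c" using \<open>0 \<le> q\<close> \<open>q < 1\<close> by (simp add: c_def)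
  define r where "r = 2 / (1 + q) * q"
  have r: "0 \<le> r" "r < 1" using \<open>0 \<le> q\<close> \<open>q < 1\<close> by (simp_all add: r_def field_simps)
  have exp_c: "exp c = 2 / (1 + q)" using \<open>0 \<le> q\<close> by (simp add: c_def)
  have int_c: "integrable L (\<lambda>x. exp (c - x))" "law.expectation (\<lambda>x. exp (c - x)) = r"
  proof -
    have eq: "(\<lambda>x. exp (c - x)) = (\<lambda>x. exp c * exp (- x))" by (simp flip: exp_add)
    show "integrable L (\<lambda>x. exp (c - x))" "law.expectation (\<lambda>x. exp (c - x)) = r"
      unfolding eq using int by (simp_all add: r_def exp_c q_def)
  qed
  define W where "W n \<omega> = (\<Sum>i\<in>{1..n}. \<Prod>a\<in>{i} \<times> {1..n}. exp (c - X (fst a) (snd a) \<omega>))" for n \<omega>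
  have "AE \<omega> in M. (\<lambda>n. W n \<omega>) \<longlonglongrightarrow> 0"
  proof (rule AE_tendsto_0_if_summable_integral)
    have prods: "integrable M (\<lambda>\<omega>. \<Prod>a\<in>{i} \<times> {1..n}. exp (c - X (fst a) (snd a) \<omega>))"
      "expectation (\<lambda>\<omega>. \<Prod>a\<in>{i} \<times> {1..n}. exp (c - X (fst a) (snd a) \<omega>)) = r ^ n"
      if "i \<in> {1..n}" for i n
    proof -
      have "{i} \<times> {1..n} \<subseteq> {1..} \<times> {1..}" using that by auto
      note I = finite_cartesian_product[OF finite.insertI[OF finite.emptyI] finite_atLeastAtMost] this
      show "integrable M (\<lambda>\<omega>. \<Prod>a\<in>{i} \<times> {1..n}. exp (c - X (fst a) (snd a) \<omega>))"
        by (rule integrable_prod_entries[OF I int_c(1)])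
      have "expectation (\<lambda>\<omega>. \<Prod>a\<in>{i} \<times> {1..n}. exp (c - X (fst a) (snd a) \<omega>))
          = (\<Prod>a\<in>{i} \<times> {1..n}. law.expectation (\<lambda>x. exp (c - x)))"
        by (rule expectation_prod_entries[OF I int_c(1)])
      then show "expectation (\<lambda>\<omega>. \<Prod>a\<in>{i} \<times> {1..n}. exp (c - X (fst a) (snd a) \<omega>)) = r ^ n"
        by (simp add: int_c(2) card_cartesian_product)
    qed
    show "integrable M (W n)" for n
      unfolding W_def[abs_def] by (intro Bochner_Integration.integrable_sum prods)
    show "0 \<le> W n \<omega>" for n \<omega> unfolding W_def by (intro sum_nonneg prod_nonneg) simp
    have "expectation (W n) = real n * r ^ n" for n
    proof -
      have "expectation (W n) = (\<Sum>i\<in>{1..n}. r ^ n)"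
        unfolding W_def[abs_def]
        by (intro trans[OF Bochner_Integration.integral_sum] sum.cong refl prods)
      then show ?thesis by simp
    qed
    moreover have "summable (\<lambda>n. real n * r ^ n)"
    proof (rule summable_comparison_test')
      show "summable (\<lambda>n. of_nat (Suc n) * r ^ n)"
        using geometric_deriv_sums[of r] r by (auto simp: sums_iff)
      show "norm (real n * r ^ n) \<le> of_nat (Suc n) * r ^ n" for n
        using r by (simp add: mult_right_mono)
    qed
    ultimately show "summable (\<lambda>n. expectation (W n))" by simp
  qed
  then have "AE \<omega> in M. \<forall>\<^sub>F n in sequentially. \<forall>i\<in>{1..n}. c * real n \<le> (\<Sum>l\<in>{1..n}. X i l \<omega>)"
  proof eventually_elim
    case (elim \<omega>)
    from order_tendstoD(2)[OF elim, of 1] have "\<forall>\<^sub>F n in sequentially. W n \<omega> < 1" by simp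
    then show ?case
    proof eventually_elim
      case (elim n)
      show ?case
      proof
        fix i assume i: "i \<in> {1..n}"
        have "(\<Prod>a\<in>{i} \<times> {1..n}. exp (c - X (fst a) (snd a) \<omega>))
            = exp (\<Sum>a\<in>{i} \<times> {1..n}. c - X (fst a) (snd a) \<omega>)"
          by (simp add: exp_sum)
        also have "(\<Sum>a\<in>{i} \<times> {1..n}. c - X (fst a) (snd a) \<omega>)
            = c * real n - (\<Sum>l\<in>{1..n}. X i l \<omega>)"
          by (simp add: sum.cartesian_product' sum_subtractf)
        finally have "exp (c * real n - (\<Sum>l\<in>{1..n}. X i l \<omega>))
            = (\<Prod>a\<in>{i} \<times> {1..n}. exp (c - X (fst a) (snd a) \<omega>))" ..
        also have "\<dots> \<le> W n \<omega>"
          unfolding W_def using i by (intro member_le_sum prod_nonneg) auto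
        also have "\<dots> < 1" by (rule elim)
        finally show "c * real n \<le> (\<Sum>l\<in>{1..n}. X i l \<omega>)" by simp
      qed
    qed
  qed
  with c show ?thesis by blast
qed

end

section \<open>Total variation convergence of the invariant distributions\<close>

lemma return_0_if_AE_zero:
  fixes L :: "real measure"
  assumes "prob_space L" "sets L = sets borel" "AE x in L. x = 0"
  shows "L = return borel 0"
proof (rule measure_eqI)
  interpret L: prob_space L by fact
  fix S assume S: "S \<in> sets L"
  have "emeasure L S = emeasure L (if 0 \<in> S then space L else {})"
    using assms(3) S by (intro emeasure_eq_AE) (auto elim!: eventually_mono)
  also have "\<dots> = emeasure (return borel 0) S"
    using S assms(2) by (simp add: L.emeasure_space_1 indicator_def)
  finally show "emeasure L S = emeasure (return borel 0) S" .
qed (use assms(2) in simp)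

theorem theorem1p4:
  fixes M :: "'a measure"
    and L :: "real measure"
    and X :: "nat \<Rightarrow> nat \<Rightarrow> 'a \<Rightarrow> real"
    and \<theta> :: "nat \<Rightarrow> 'a \<Rightarrow> real"
  defines "A \<equiv> (\<lambda>\<omega>. scaled_matrix (\<lambda>i. \<theta> i \<omega>) (\<lambda>i j. X i j \<omega>))"
  assumes "prob_space M"
    and "prob_space L" and "sets L = sets borel"
    and "AE x in L. 0 \<le> x"
    and "\<nexists>c. L = return borel c"
    and "prob_space.indep_vars M (\<lambda>_. borel) (\<lambda>(i, j). X i j) ({1..} \<times> {1..})"
    and "\<And>i j. 1 \<le> i \<Longrightarrow> 1 \<le> j \<Longrightarrow> distr M borel (X i j) = L"
    and "\<And>i. 1 \<le> i \<Longrightarrow> \<theta> i \<in> borel_measurable M"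
    and "\<And>i \<omega>. 1 \<le> i \<Longrightarrow> \<omega> \<in> space M \<Longrightarrow> 0 < \<theta> i \<omega>"
    and "integrable L (\<lambda>x. x ^ 2)"
  shows "(AE \<omega> in M. (\<lambda>n. tv_norm n (\<lambda>i.
            kernel_invariant n (kernel_P n (A \<omega>)) i - uniform_vector n i)) \<longlonglongrightarrow> 0) \<and>
         (AE \<omega> in M. (\<lambda>n. tv_norm n (\<lambda>i.
            kernel_invariant n (kernel_Q_hat n (A \<omega>)) i - uniform_vector n i)) \<longlonglongrightarrow> 0) \<and>
         ((\<exists>c>0. \<forall>i\<ge>1. \<forall>\<omega>\<in>space M. \<theta> i \<omega> = c) \<longrightarrow>
           (AE \<omega> in M. (\<lambda>n. tv_norm n (\<lambda>i.
              generator_invariant n (generator_Q n (A \<omega>)) i - uniform_vector n i)) \<longlonglongrightarrow> 0))"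
proof -
  interpret iid_array M L X
    using assms by (intro iid_array.intro iid_array_axioms.intro) auto
  define m where "m = law.expectation (\<lambda>x. x)"
  have "\<not> (AE x in L. x = 0)"
    using return_0_if_AE_zero[of L] assms by blast
  then obtain c where c: "0 < c" and rows: "AE \<omega> in M. \<forall>\<^sub>F n in sequentially. \<forall>i\<in>{1..n}.
      c * real n \<le> (\<Sum>l\<in>{1..n}. X i l \<omega>)"
    using row_sums_grow_linearly assms by blast
  have "AE \<omega> in M. \<forall>i\<ge>1. \<forall>j\<ge>1. 0 \<le> X i j \<omega>"
    using assms by (intro AE_all_entries) auto
  moreover have "AE \<omega> in M. \<forall>\<delta>>0. \<forall>\<^sub>F n in sequentially.
      left_op_bound n (\<lambda>i j. X i j \<omega> - m) (\<delta> * real n)"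
    unfolding m_def using assms by (intro centred_array_op_norm_is_o) auto
  ultimately have flat: "AE \<omega> in M. asymptotically_flat_array (\<lambda>i j. X i j \<omega>) m c"
    using rows
  proof eventually_elim
    case (elim \<omega>)
    show ?case by standard (use elim c in auto)
  qed
  have \<theta>: "\<theta> i \<omega> \<noteq> 0" if "1 \<le> i" "\<omega> \<in> space M" for i \<omega>
    using assms that by (metis less_irrefl)
  have "AE \<omega> in M. (\<lambda>n. tv_norm n (\<lambda>i.
      kernel_invariant n (kernel_P n (A \<omega>)) i - uniform_vector n i)) \<longlonglongrightarrow> 0"
    using flat AE_space
  proof eventually_elim
    case (elim \<omega>)
    have "kernel_invariant n (kernel_P n (A \<omega>)) = kernel_invariant n (kernel_P n (\<lambda>i j. X i j \<omega>))"
      for n unfolding A_def using \<theta> elim(2)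
      by (intro kernel_invariant_cong kernel_P_scaled_matrix) auto
    then show ?case
      using asymptotically_flat_array.kernel_invariant_tendsto_uniform[OF elim(1)] by simp
  qed
  moreover have "AE \<omega> in M. (\<lambda>n. tv_norm n (\<lambda>i.
      kernel_invariant n (kernel_Q_hat n (A \<omega>)) i - uniform_vector n i)) \<longlonglongrightarrow> 0"
    using flat AE_space
  proof eventually_elim
    case (elim \<omega>)
    have "kernel_invariant n (kernel_Q_hat n (A \<omega>))
        = kernel_invariant n (kernel_P n (\<lambda>i j. if i = j then 0 else X i j \<omega>))"
      for n unfolding A_def using \<theta> elim(2)
      by (intro kernel_invariant_cong kernel_Q_hat_eq_kernel_P) auto
    then show ?case
      using asymptotically_flat_array.kernel_invariant_tendsto_uniform[OF
          asymptotically_flat_array.asymptotically_flat_zero_diagonal[OF elim(1)]] by simp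
  qed
  moreover have "AE \<omega> in M. (\<lambda>n. tv_norm n (\<lambda>i.
      generator_invariant n (generator_Q n (A \<omega>)) i - uniform_vector n i)) \<longlonglongrightarrow> 0"
    if const: "\<exists>c>0. \<forall>i\<ge>1. \<forall>\<omega>\<in>space M. \<theta> i \<omega> = c"
  proof -
    obtain b where b: "0 < b" "\<And>i \<omega>. 1 \<le> i \<Longrightarrow> \<omega> \<in> space M \<Longrightarrow> \<theta> i \<omega> = b"
      using const by blast
    show ?thesis using flat AE_space
    proof eventually_elim
      case (elim \<omega>)
      have "generator_invariant n (generator_Q n (A \<omega>))
          = generator_invariant n (generator_Q n (\<lambda>i j. X i j \<omega>))" for n
        by (rule generator_invariant_scale[of b])
          (use b elim(2) in \<open>auto simp: A_def scaled_matrix_def\<close>)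
      then show ?case
        using asymptotically_flat_array.generator_invariant_tendsto_uniform[OF elim(1)] by simp
    qed
  qed
  ultimately show ?thesis by blast
qed

end
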